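(* Let $(T^*SU(3))_{\rm impl}$ be the universal imploded cross-section of $SU(3)$, that is, the complex quadric hypersurface $\{(z,w)\in\mathbb{C}^3\times\mathbb{C}^3 : z_1w_1+z_2w_2+z_3w_3=0\}$. Its middle-perversity intersection cohomology with real coefficients is $$IH^j\big((T^*SU(3))_{\rm impl}\big)\cong\begin{cases}\mathbb{R}, & j=0,4,\\ 0, & j=1,2,3 \text{ and } j\ge 5.\end{cases}$$
   Context: Imploded cross-section: let $K$ be a compact Lie group with Lie algebra $\mathfrak{k}$, maximal torus $T$ and closed fundamental Weyl chamber $\mathfrak{t}^*_+$, and let $(M,\omega)$ be a Hamiltonian $K$-manifold with moment map $\Phi:M\to\mathfrak{k}^*$. For $\lambda\in\mathfrak{k}^*$ let $K_\lambda$ be its stabilizer (centralizer) in $K$ and $[K_\lambda,K_\lambda]$ the commutator subgroup of $K_\lambda$. The imploded cross-section is the quotient space $M_{\rm impl}=\Phi^{-1}(\mathfrak{t}^*_+)/\sim$ with the quotient topology, where $m_1\sim m_2$ if $m_2=km_1$ for some $k\in[K_{\Phi(m_1)},K_{\Phi(m_1)}]$. The universal imploded cross-section of $K$ is the imploded cross-section $(T^*K)_{\rm impl}$ of the cotangent bundle $T^*K$ with its Hamiltonian $K$-action lifted from translation on $K$. For $K=SU(3)$ it is known (Guillemin–Jeffrey–Sjamaar) that $(T^*SU(3))_{\rm impl}$ is identified with the complex hypersurface $\{(z,w)\in\mathbb{C}^3\times\mathbb{C}^3 : z\cdot w=0\}$, where $z\cdot w=\sum_{k=1}^3 z_kw_k$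 (complex bilinear, no conjugation). It has complex dimension $5$ and an isolated singularity at the origin. Convention: $IH^*$ denotes intersection cohomology with middle perversity and real coefficients (the dual of intersection homology with compact supports), with the indexing for which $IH^*$ of a smooth manifold is its ordinary cohomology. With this convention, for the open cone $C(Y)$ on a compact manifold $Y$ of real dimension $2n-1$, one has $IH^i(C(Y))\cong H^i(Y)$ for $i\le n-1$ and $IH^i(C(Y))=0$ for $i\ge n$. *)

theory Defs
  imports "HOL-Analysis.Analysis" "HOL-Homology.Homology"
begin

section \<open>Singular chains with real coefficients\<close>

instantiation poly_mapping :: (type, real_vector) real_vector
begin

lift_definition scaleR_poly_mapping :: "real \<Rightarrow> ('a \<Rightarrow>\<^sub>0 'b) \<Rightarrow> ('a \<Rightarrow>\<^sub>0 'b)"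
  is "\<lambda>r f x. r *\<^sub>R f x"
  by (erule finite_subset[rotated]) auto

instance
  by standard (transfer; simp add: fun_eq_iff scaleR_add_right scaleR_add_left)+

end

type_synonym 'a real_chain = "((nat \<Rightarrow> real) \<Rightarrow> 'a) \<Rightarrow>\<^sub>0 real"

text \<open>The real-coefficient analogue of \<^const>\<open>chain_boundary\<close>, with the same convention in
  degree \<open>0\<close>.\<close>

definition real_chain_boundary :: "nat \<Rightarrow> 'a real_chain \<Rightarrow> 'a real_chain" where
  "real_chain_boundary i c =
     (if i = 0 then 0
      else (\<Sum>\<sigma>\<in>Poly_Mapping.keys c. \<Sum>k\<le>i.
              Poly_Mapping.single (singular_face i k \<sigma>) ((-1) ^ k * Poly_Mapping.lookup c \<sigma>)))"


section \<open>Intersection homology and cohomology\<close>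

text \<open>
  King's singular intersection homology of a space \<open>X\<close> of real dimension \<open>n\<close> with closed filtration
  \<open>\<dots> \<subseteq> F (n-2) \<subseteq> F n = topspace X\<close>; the index is an integer so that \<open>F k = {}\<close> for negative
  \<open>k\<close>. The stratum of codimension \<open>k\<close> is \<open>F (n-k) - F (n-k-1)\<close>. A perversity assigns an integer to
  each codimension \<open>k \<ge> 2\<close>; as in Goresky--MacPherson there are no strata of codimension one,
  and the open stratum imposes no condition.
\<close>

definition simplex_skeleton :: "nat \<Rightarrow> int \<Rightarrow> (nat \<Rightarrow> real) set" where
  "simplex_skeleton i m = {x \<in> standard_simplex i. int (card {l. x l \<noteq> 0}) \<le> m + 1}"

definition middle_perversity :: "nat \<Rightarrow> int" where
  "middle_perversity k = (int k - 2) div 2"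

definition allowable_simplices ::
    "'a topology \<Rightarrow> nat \<Rightarrow> (int \<Rightarrow> 'a set) \<Rightarrow> (nat \<Rightarrow> int) \<Rightarrow> nat \<Rightarrow> ((nat \<Rightarrow> real) \<Rightarrow> 'a) set" where
  "allowable_simplices X n F p i =
     {\<sigma>. singular_simplex i X \<sigma> \<and>
         (\<forall>k\<ge>2. {x \<in> standard_simplex i. \<sigma> x \<in> F (int n - int k) - F (int n - int k - 1)}
                 \<subseteq> simplex_skeleton i (int i - int k + p k))}"

definition intersection_chains ::
    "'a topology \<Rightarrow> nat \<Rightarrow> (int \<Rightarrow> 'a set) \<Rightarrow> (nat \<Rightarrow> int) \<Rightarrow> nat \<Rightarrow> 'a real_chain set" where
  "intersection_chains X n F p i =
     {c. Poly_Mapping.keys c \<subseteq> allowable_simplices X n F p i \<and>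
         Poly_Mapping.keys (real_chain_boundary i c) \<subseteq> allowable_simplices X n F p (i - 1)}"

definition intersection_cycles ::
    "'a topology \<Rightarrow> nat \<Rightarrow> (int \<Rightarrow> 'a set) \<Rightarrow> (nat \<Rightarrow> int) \<Rightarrow> nat \<Rightarrow> 'a real_chain set" where
  "intersection_cycles X n F p i =
     {c \<in> intersection_chains X n F p i. real_chain_boundary i c = 0}"

definition intersection_boundaries ::
    "'a topology \<Rightarrow> nat \<Rightarrow> (int \<Rightarrow> 'a set) \<Rightarrow> (nat \<Rightarrow> int) \<Rightarrow> nat \<Rightarrow> 'a real_chain set" where
  "intersection_boundaries X n F p i =
     real_chain_boundary (Suc i) ` intersection_chains X n F p (Suc i)"

definition intersection_class ::
    "'a topology \<Rightarrow> nat \<Rightarrow> (int \<Rightarrow> 'a set) \<Rightarrow> (nat \<Rightarrow> int) \<Rightarrow> nat \<Rightarrow> 'a real_chain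
      \<Rightarrow> 'a real_chain set" where
  "intersection_class X n F p i c = (\<lambda>b. c + b) ` intersection_boundaries X n F p i"

text \<open>The quotient space cycles/boundaries, as a set of cosets.\<close>

definition intersection_homology ::
    "'a topology \<Rightarrow> nat \<Rightarrow> (int \<Rightarrow> 'a set) \<Rightarrow> (nat \<Rightarrow> int) \<Rightarrow> nat \<Rightarrow> 'a real_chain set set" where
  "intersection_homology X n F p i =
     intersection_class X n F p i ` intersection_cycles X n F p i"

text \<open>
  The real dual of intersection homology: functionals on the set of cosets that are linear for the
  quotient vector space structure \<open>a[x] + b[y] = [ax + by]\<close>. They are normalised to \<open>0\<close> off
  \<^const>\<open>intersection_homology\<close>, so that they are determined by their values there and the
  vector space operations are pointwise.
\<close>

definition intersection_cohomology ::
    "'a topology \<Rightarrow> nat \<Rightarrow> (int \<Rightarrow> 'a set) \<Rightarrow> (nat \<Rightarrow> int) \<Rightarrow> nat \<Rightarrow> ('a real_chain set \<Rightarrow> real) set"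
  where
  "intersection_cohomology X n F p i =
     {\<phi>. (\<forall>h. h \<notin> intersection_homology X n F p i \<longrightarrow> \<phi> h = 0) \<and>
         (\<forall>x\<in>intersection_cycles X n F p i. \<forall>y\<in>intersection_cycles X n F p i. \<forall>a b.
            \<phi> (intersection_class X n F p i (a *\<^sub>R x + b *\<^sub>R y)) =
              a * \<phi> (intersection_class X n F p i x) + b * \<phi> (intersection_class X n F p i y))}"

text \<open>Isomorphism of real vector spaces, between a space of real-valued functions with pointwise
  operations and a subspace of a real vector space.\<close>

definition linearly_isomorphic :: "('x \<Rightarrow> real) set \<Rightarrow> 'v::real_vector set \<Rightarrow> bool"
  (infix "\<cong>\<^sub>\<real>" 50) where
  "V \<cong>\<^sub>\<real> W \<longleftrightarrow>
     (\<exists>T. bij_betw T V W \<and>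
          (\<forall>f\<in>V. \<forall>g\<in>V. \<forall>a b. T (\<lambda>x. a * f x + b * g x) = a *\<^sub>R T f + b *\<^sub>R T g))"


section \<open>The universal imploded cross-section of SU(3)\<close>

text \<open>The quadric hypersurface with which the imploded cross-section of \<open>T\<^sup>*SU(3)\<close> is identified by
  Guillemin, Jeffrey and Sjamaar. The product \<open>z \<cdot> w\<close> is complex bilinear, so it is not the inner product of the library.\<close>

definition SU3_implosion :: "((complex ^ 3) \<times> (complex ^ 3)) set" where
  "SU3_implosion = {(z, w). (\<Sum>k\<in>UNIV. z $ k * w $ k) = 0}"

text \<open>Real dimension \<open>10\<close>, with the origin as only singular stratum.\<close>

definition SU3_implosion_filtration :: "int \<Rightarrow> ((complex ^ 3) \<times> (complex ^ 3)) set" where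
  "SU3_implosion_filtration k = (if k < 0 then {} else if k < 10 then {0} else SU3_implosion)"

definition IH_SU3_implosion ::
    "nat \<Rightarrow> (((complex ^ 3) \<times> (complex ^ 3)) real_chain set \<Rightarrow> real) set" where
  "IH_SU3_implosion j =
     intersection_cohomology (top_of_set SU3_implosion) 10 SU3_implosion_filtration
       middle_perversity j"

end

theory Submission
  imports Defs
begin

text \<open>
  The hypersurface \<open>X = {z \<cdot> w = 0}\<close> is a cone with its only singular point at the origin, of real
  dimension \<open>10\<close>. The middle perversity takes the value \<open>4\<close> in codimension \<open>10\<close>, so a singular
  \<open>i\<close>-simplex is allowable exactly when it meets the origin only in its skeleton of dimension \<open>i - 6\<close>.
  Two regimes follow.

  For \<open>i \<ge> 5\<close> the cone on an allowable \<open>i\<close>-simplex with apex at the origin is again allowable: coning raises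
  the dimension of the simplex and that of the set where it meets the origin by one, and the apex itself is a
  vertex, which is admitted from dimension \<open>6\<close> on. As the boundary of the cone on a cycle is the cycle,
  intersection homology vanishes in these degrees (\<open>SU3_cycles_bound_high\<close>).

  Simplices of dimension at most \<open>5\<close> must avoid the origin, so for \<open>i \<le> 4\<close> intersection homology is the
  ordinary real homology of \<open>N = X - {0}\<close>. In suitable coordinates the quadratic form \<open>z \<cdot> w\<close> on \<open>\<complex>\<^sup>6\<close> is a sum of six
  squares. Writing a vector of \<open>\<complex>\<^sup>6\<close> as \<open>x + iy\<close> in such coordinates, \<open>N\<close> becomes the set of pairs of
  orthogonal vectors of equal nonzero length in \<open>\<real>\<^sup>6\<close>, and by the Gram--Schmidt process \<open>N\<close> is homotopy
  equivalent to the space \<open>M\<close> of linearly independent pairs \<open>(x, y)\<close>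
  (\<open>punctured_implosion_homotopy_equivalent_frames\<close>).

  The space \<open>M\<close> fibres over \<open>B = \<real>\<^sup>6 - {0}\<close> by \<open>(x, y) \<mapsto> x\<close>, with fibre homotopy equivalent to \<open>S\<^sup>4\<close>. Let \<open>B'\<close>
  be the complement of a closed ray in \<open>\<real>\<^sup>6\<close>, which is contractible, and let \<open>M'\<close> be the part of \<open>M\<close> over it; then
  \<open>M'\<close> is homotopy equivalent to the fibre (\<open>frames_off_ray_homotopy_equivalent\<close>). By excision the pair
  \<open>(M, M')\<close> has the homology of \<open>(\<real>\<^sup>5, \<real>\<^sup>5 - {0}) \<times> S\<^sup>4\<close>, which vanishes below degree \<open>5\<close>
  (\<open>trivial_cylinder\<close>) and in degree \<open>5\<close> injects into that of \<open>(B, B')\<close> (\<open>inj_on_hom_induced_cylinder\<close>).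
  So \<open>H\<^sub>i(M') \<rightarrow> H\<^sub>i(M)\<close> is an isomorphism for \<open>i \<le> 4\<close> as soon as the boundary map \<open>H\<^sub>5(M, M') \<rightarrow> H\<^sub>4(M')\<close>
  vanishes. That map is multiplication by the Euler number of the tangent bundle of \<open>S\<^sup>5\<close>, and it is zero because the
  complex structure gives the section \<open>x \<mapsto> (x, ix)\<close>: a class of \<open>H\<^sub>5(M, M')\<close> is the image under the section of a
  class of \<open>H\<^sub>5(B, B')\<close>, whose boundary lies in \<open>H\<^sub>4(B') = 0\<close> (\<open>hom_boundary_frames_trivial\<close>). Hence \<open>N\<close> has the
  integral homology of \<open>S\<^sup>4\<close> in degrees up to \<open>4\<close>.

  It remains to pass from integral to real chains. A basis of \<open>\<real>\<close> over \<open>\<rat>\<close> splits a real cycle into real multiples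
  of integral cycles (\<open>real_cycle_decomposition\<close>), and an additive retraction \<open>\<real> \<rightarrow> \<rat>\<close> shows that an
  integral cycle of infinite order does not become a boundary over \<open>\<real>\<close> (\<open>integral_multiple_bounds\<close>).
\<close>

section \<open>Homotopies and excision across a half space\<close>

lemma homotopic_with_top_of_setI:
  fixes H :: "real \<times> 'a::topological_space \<Rightarrow> 'b::topological_space"
  assumes "continuous_on ({0..1} \<times> S) H"
    and "\<And>t x. \<lbrakk>0 \<le> t; t \<le> 1; x \<in> S\<rbrakk> \<Longrightarrow> H (t, x) \<in> T"
    and "\<And>x. x \<in> S \<Longrightarrow> H (0, x) = f x" "\<And>x. x \<in> S \<Longrightarrow> H (1, x) = g x"
    and "\<And>t. \<lbrakk>0 \<le> t; t \<le> 1\<rbrakk> \<Longrightarrow> P (\<lambda>x. H (t, x))"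
    and cong: "\<And>h k. (\<And>x. x \<in> S \<Longrightarrow> h x = k x) \<Longrightarrow> P h = P k"
  shows "homotopic_with P (top_of_set S) (top_of_set T) f g"
proof -
  have "prod_topology (top_of_set {0..1::real}) (top_of_set S) = top_of_set ({0..1} \<times> S)"
    by (simp add: prod_topology_subtopology subtopology_subtopology Times_Int_Times)
  then have "continuous_map (prod_topology (top_of_set {0..1}) (top_of_set S)) (top_of_set T) H"
    using assms(1,2) by auto
  then have "\<exists>h. continuous_map (prod_topology (top_of_set {0..1::real}) (top_of_set S)) (top_of_set T) h \<and>
      (\<forall>x\<in>S. h (0, x) = f x) \<and> (\<forall>x\<in>S. h (1, x) = g x) \<and> (\<forall>t\<in>{0..1}. P (\<lambda>x. h (t, x)))"
    using assms(3-5) by (intro exI[of _ H] conjI ballI) simp_all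
  then have ex: "\<exists>h. continuous_map (prod_topology (top_of_set {0..1::real}) (top_of_set S)) (top_of_set T) h \<and>
      (\<forall>x\<in>topspace (top_of_set S). h (0, x) = f x) \<and> (\<forall>x\<in>topspace (top_of_set S). h (1, x) = g x) \<and>
      (\<forall>t\<in>{0..1}. P (\<lambda>x. h (t, x)))"
    by (simp only: topspace_subtopology topspace_euclidean Int_UNIV_left)
  have "P h = P k" if "\<And>x. x \<in> topspace (top_of_set S) \<Longrightarrow> h x = k x" for h k
    by (rule cong) (simp add: that)
  from homotopic_with[where P = P, OF this, THEN iffD2, OF _ ex] show ?thesis
    by blast
qed

lemma excision_of_closed:
  assumes "openin X T" "closedin X U" "U \<subseteq> T"
  shows "hom_induced p (subtopology X (topspace X - U)) (T - U) X T id
           \<in> iso (relative_homology_group p (subtopology X (topspace X - U)) (T - U))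
                 (relative_homology_group p X T)"
proof -
  have "X closure_of U \<subseteq> X interior_of T"
    using assms by (simp add: closure_of_closedin interior_of_openin)
  moreover have "T \<subseteq> topspace X"
    using assms(1) openin_subset by blast
  ultimately show ?thesis
    using homology_excision_axiom[of X U T "topspace X" p] by simp
qed

text \<open>
  What is left of \<open>S\<close> after the half \<open>h \<le> 0\<close> has been removed is the open half \<open>h > 0\<close>. The removed part is closed in
  \<open>S\<close> and lies in the open set \<open>T\<close>, because a point of \<open>S\<close> with \<open>h = 0\<close> belongs to \<open>D\<close>.
\<close>

lemma iso_excise_lower_half:
  fixes h :: "'a \<Rightarrow> real"
  assumes h: "continuous_map X euclideanreal h" and D: "openin X D"
    and S: "S = D \<union> {x \<in> topspace X. h x \<noteq> 0}"
    and T: "T = D \<union> {x \<in> topspace X. h x < 0}"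
    and P: "P = {x \<in> topspace X. 0 < h x}"
  shows "hom_induced p (subtopology X P) (D \<inter> P) (subtopology X S) T id
           \<in> iso (relative_homology_group p (subtopology X P) (D \<inter> P))
                 (relative_homology_group p (subtopology X S) T)"
proof -
  let ?Y = "subtopology X S" and ?U = "{x \<in> S. h x \<le> 0}"
  have DX: "D \<subseteq> topspace X"
    using D openin_subset by blast
  have SX: "S \<subseteq> topspace X"
    using DX S by auto
  then have topY: "topspace ?Y = S"
    by auto
  have hY: "continuous_map ?Y euclideanreal h"
    using h continuous_map_from_subtopology by blast
  have "openin X {x \<in> topspace X. h x \<in> {..<0}}"
    by (rule openin_continuous_map_preimage [OF h]) auto
  then have "openin X T"
    unfolding T using D by (intro openin_Un) auto
  then have opT: "openin ?Y T"
    unfolding openin_subtopology using S T by (intro exI[of _ T]) auto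
  have "{x \<in> topspace ?Y. h x \<in> {..0}} = ?U"
    unfolding topY by auto
  moreover have "closedin ?Y {x \<in> topspace ?Y. h x \<in> {..0}}"
    by (rule closedin_continuous_map_preimage [OF hY]) auto
  ultimately have clU: "closedin ?Y ?U"
    by simp
  have "?U \<subseteq> T"
    using S T DX by force
  note excision_of_closed[OF opT clU this, of p]
  moreover have "S \<inter> (S - ?U) = P" "T - ?U = D \<inter> P"
    using S T P DX by auto
  ultimately show ?thesis
    by (simp only: topY subtopology_subtopology)
qed

lemma trivial_group_if_inj_on:
  assumes "f \<in> hom G H" "inj_on f (carrier G)" "trivial_group H" "group G" "group H"
  shows "trivial_group G"
proof -
  interpret G: group G by fact
  have "x = \<one>\<^bsub>G\<^esub>" if x: "x \<in> carrier G" for x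
  proof -
    have "f x = f \<one>\<^bsub>G\<^esub>"
      using assms(3) hom_in_carrier[OF assms(1) x] hom_in_carrier[OF assms(1) G.one_closed]
      by (auto simp: trivial_group_def)
    then show ?thesis
      using assms(2) x by (auto dest: inj_onD)
  qed
  then show ?thesis
    using assms(4) by (auto simp: trivial_group_def)
qed

text \<open>
  The exact sequence of the triple \<open>(X, S, T)\<close>. Together with \<open>iso_excise_lower_half\<close> it compares the homology of
  \<open>(X, S)\<close> with that of the pair \<open>(P, D \<inter> P)\<close> over the half \<open>h > 0\<close>, one degree lower; this is the suspension
  isomorphism in the form needed for the inductions below.
\<close>

lemma inj_on_hom_relboundary:
  assumes "T \<subseteq> S" "trivial_group (relative_homology_group p X T)"
  shows "inj_on (hom_relboundary p X S T) (carrier (relative_homology_group p X S))"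
proof -
  have "exact_seq ([relative_homology_group(p-1) (subtopology X S) T, relative_homology_group p X S,
                     relative_homology_group p X T], [hom_relboundary p X S T, hom_induced p X T X S id])"
    by (rule homology_exactness_triple_1 [OF assms(1)])
  moreover have hom: "group_hom (relative_homology_group p X S) (relative_homology_group(p-1) (subtopology X S) T)
       (hom_relboundary p X S T)"
    by (simp add: group_hom_def group_hom_axioms_def group_homomorphism_hom_relboundary)
  ultimately have ex: "hom_induced p X T X S id ` carrier (relative_homology_group p X T)
     = kernel (relative_homology_group p X S) (relative_homology_group(p-1) (subtopology X S) T)
       (hom_relboundary p X S T)"
    by auto
  have "hom_induced p X T X S id \<one>\<^bsub>relative_homology_group p X T\<^esub> = \<one>\<^bsub>relative_homology_group p X S\<^esub>"
    by (intro hom_one hom_induced_hom) auto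
  then show ?thesis
    using ex assms(2) group_hom.inj_iff_trivial_ker[OF hom] by (simp add: trivial_group_def)
qed


section \<open>Cylinders relative to the complement of a coordinate subspace\<close>

text \<open>
  The complement of the orthogonal complement of \<open>S\<close>. When \<open>S\<close> consists of \<open>k\<close> vectors of an orthonormal
  basis and \<open>C\<close> is closed under translations along them, \<open>(C, C \<inter> off_perp S)\<close> is the product of a space with the
  pair formed by \<open>\<real>\<^sup>k\<close> and \<open>\<real>\<^sup>k - {0}\<close>.
\<close>

definition off_perp :: "'b::euclidean_space set \<Rightarrow> 'b set" where
  "off_perp S = {x. \<exists>b\<in>S. x \<bullet> b \<noteq> 0}"

lemma open_off_perp: "open (off_perp (S :: 'b::euclidean_space set))"
proof -
  have "off_perp S = (\<Union>b\<in>S. {x. x \<bullet> b \<noteq> 0})"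
    by (auto simp: off_perp_def)
  moreover have "open {x. x \<bullet> b \<noteq> 0}" for b :: 'b
    by (intro open_Collect_neq continuous_intros)
  ultimately show ?thesis
    by auto
qed

text \<open>
  Pushing the coordinate \<open>x \<bullet> b\<close> linearly to \<open>- 1\<close> moves everything into the lower half. It changes no coordinate in
  \<open>S\<close>, and a negative coordinate stays negative, so the subset is preserved all the time.
\<close>

lemma trivial_cylinder_lower_half:
  fixes C :: "'b::euclidean_space set" and A :: "'a::topological_space set"
  assumes S: "S \<subseteq> Basis" "b \<in> Basis" "b \<notin> S"
    and C: "\<And>x r. x \<in> C \<Longrightarrow> x + r *\<^sub>R b \<in> C"
  shows "trivial_group (relative_homology_group p (top_of_set (C \<times> A))
           ((C \<inter> (off_perp S \<union> {x. x \<bullet> b < 0})) \<times> A))"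
proof -
  let ?X = "top_of_set (C \<times> A)" and ?T = "(C \<inter> (off_perp S \<union> {x. x \<bullet> b < 0})) \<times> A"
  define H where "H = (\<lambda>(t::real, x::'b, a::'a). (x - ((1 - t) * (x \<bullet> b + 1)) *\<^sub>R b, a))"
  have HC: "H (t, x, a) \<in> C \<times> A" if "x \<in> C" "a \<in> A" for t x a
    using C[OF that(1), of "- ((1 - t) * (x \<bullet> b + 1))"] that by (simp add: H_def)
  have Hb: "fst (H (t, x, a)) \<bullet> b = t * (x \<bullet> b) - (1 - t)" for t x a
    using S by (simp add: H_def inner_diff_left algebra_simps)
  have Hc: "fst (H (t, x, a)) \<bullet> c = x \<bullet> c" if "c \<in> S" for t x a c
  proof -
    have "b \<bullet> c = 0"
      using S that by (metis inner_not_same_Basis subsetD)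
    then show ?thesis
      by (simp add: H_def inner_diff_left)
  qed
  have HT: "H (t, x, a) \<in> ?T" if "(x, a) \<in> ?T" "0 \<le> t" "t \<le> 1" for t x a
  proof (cases "x \<in> off_perp S")
    case True
    then show ?thesis
      using HC[of x a t] that Hc unfolding off_perp_def by (auto simp: mem_Times_iff)
  next
    case False
    then have "x \<bullet> b < 0"
      using that by auto
    then have "t * (x \<bullet> b) - (1 - t) < 0"
      using that mult_nonneg_nonpos[of t "x \<bullet> b"] by (cases "t = 1") auto
    then show ?thesis
      using HC[of x a t] that Hb[of t x a] by (auto simp: mem_Times_iff)
  qed
  have contH: "continuous_on UNIV H"
    unfolding H_def case_prod_unfold by (intro continuous_intros)
  show ?thesis
  proof (rule trivial_relative_homology_group_alt)
    show "continuous_map ?X (subtopology ?X ?T) (\<lambda>z. H (0, z))"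
      using HC[of _ _ 0] Hb[of 0]
      by (auto simp: subtopology_subtopology mem_Times_iff
               intro!: continuous_on_compose2[OF contH] continuous_intros)
    show "homotopic_with (\<lambda>k. k ` ?T \<subseteq> ?T) ?X ?X (\<lambda>z. H (0, z)) id"
    proof (rule homotopic_with_top_of_setI)
      show "continuous_on ({0..1} \<times> (C \<times> A)) H"
        by (rule continuous_on_subset[OF contH]) auto
    next
      fix t :: real assume "0 \<le> t" "t \<le> 1"
      then show "(\<lambda>z. H (t, z)) ` ?T \<subseteq> ?T"
        using HT by blast
    next
      fix h k :: "'b \<times> 'a \<Rightarrow> 'b \<times> 'a"
      assume "\<And>x. x \<in> C \<times> A \<Longrightarrow> h x = k x"
      then have "h ` ?T = k ` ?T"
        by (intro image_cong) auto
      then show "(h ` ?T \<subseteq> ?T) = (k ` ?T \<subseteq> ?T)"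
        by simp
    qed (use HC in \<open>auto simp: H_def\<close>)
  qed
qed

lemma subtopology_cylinder:
  "subtopology (top_of_set (C \<times> A)) ((C \<inter> D) \<times> A) = top_of_set ((C \<inter> D) \<times> A)"
  by (simp add: subtopology_subtopology) (metis Int_absorb1 Sigma_mono inf_le1 order_refl)

lemma cylinder_excision:
  fixes C :: "'b::euclidean_space set" and A :: "'a::topological_space set"
  assumes b: "b \<in> Basis"
  shows "hom_induced p (top_of_set ((C \<inter> {x. 0 < x \<bullet> b}) \<times> A)) ((C \<inter> {x. 0 < x \<bullet> b} \<inter> off_perp S) \<times> A)
            (top_of_set ((C \<inter> off_perp (insert b S)) \<times> A)) ((C \<inter> (off_perp S \<union> {x. x \<bullet> b < 0})) \<times> A) id
    \<in> iso (relative_homology_group p (top_of_set ((C \<inter> {x. 0 < x \<bullet> b}) \<times> A)) ((C \<inter> {x. 0 < x \<bullet> b} \<inter> off_perp S) \<times> A))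
          (relative_homology_group p (top_of_set ((C \<inter> off_perp (insert b S)) \<times> A)) ((C \<inter> (off_perp S \<union> {x. x \<bullet> b < 0})) \<times> A))"
proof -
  let ?X = "top_of_set (C \<times> A)" and ?D = "(C \<inter> off_perp S) \<times> A" and ?P = "(C \<inter> {x. 0 < x \<bullet> b}) \<times> A"
  have D: "openin ?X ?D"
    unfolding openin_open by (rule exI[of _ "off_perp S \<times> UNIV"]) (auto intro: open_Times open_off_perp)
  have h: "continuous_map ?X euclideanreal (\<lambda>z. fst z \<bullet> b)"
    by (auto intro!: continuous_intros)
  have "hom_induced p (subtopology ?X ?P) (?D \<inter> ?P) (subtopology ?X ((C \<inter> off_perp (insert b S)) \<times> A))
           ((C \<inter> (off_perp S \<union> {x. x \<bullet> b < 0})) \<times> A) id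
    \<in> iso (relative_homology_group p (subtopology ?X ?P) (?D \<inter> ?P))
          (relative_homology_group p (subtopology ?X ((C \<inter> off_perp (insert b S)) \<times> A)) ((C \<inter> (off_perp S \<union> {x. x \<bullet> b < 0})) \<times> A))"
    by (rule iso_excise_lower_half[OF h D]) (auto simp: off_perp_def)
  moreover have "?D \<inter> ?P = (C \<inter> {x. 0 < x \<bullet> b} \<inter> off_perp S) \<times> A"
    by auto
  ultimately show ?thesis
    by (simp only: subtopology_cylinder)
qed

text \<open>
  The pair is a space times \<open>(\<real>\<^sup>k, \<real>\<^sup>k - {0})\<close> with \<open>k = card S\<close>, a \<open>k\<close>-fold suspension, so its homology starts in
  degree \<open>k\<close>.
  The induction removes one vector \<open>b\<close> of \<open>S\<close> at the price of replacing \<open>C\<close> by its half with \<open>x \<bullet> b > 0\<close>, which is why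
  \<open>C\<close> is only asked to be closed under translations along \<open>S\<close>.
\<close>

lemma trivial_cylinder:
  fixes C :: "'b::euclidean_space set" and A :: "'a::topological_space set"
  assumes "S \<subseteq> Basis" "\<And>x b r. \<lbrakk>x \<in> C; b \<in> S\<rbrakk> \<Longrightarrow> x + r *\<^sub>R b \<in> C" "p < int (card S)"
  shows "trivial_group (relative_homology_group p (top_of_set (C \<times> A)) ((C \<inter> off_perp S) \<times> A))"
proof -
  have "finite S"
    using assms(1) finite_Basis finite_subset by blast
  then show ?thesis
    using assms
  proof (induction S arbitrary: C p)
    case empty
    then show ?case by simp
  next
    case (insert b S)
    let ?X = "top_of_set (C \<times> A)" and ?S = "(C \<inter> off_perp (insert b S)) \<times> A"
      and ?T = "(C \<inter> (off_perp S \<union> {x. x \<bullet> b < 0})) \<times> A"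
    let ?P = "C \<inter> {x. 0 < x \<bullet> b}"
    have b: "b \<in> Basis" "S \<subseteq> Basis"
      using insert by auto
    have ortho: "c \<bullet> b = 0" if "c \<in> S" for c
      using that b insert.hyps by (metis inner_not_same_Basis subsetD)
    have "?T \<subseteq> ?S"
      by (auto simp: off_perp_def)
    then have inj: "inj_on (hom_relboundary p ?X ?S ?T) (carrier (relative_homology_group p ?X ?S))"
      by (intro inj_on_hom_relboundary trivial_cylinder_lower_half) (use insert in auto)
    have "trivial_group (relative_homology_group (p-1) (top_of_set (?P \<times> A)) ((?P \<inter> off_perp S) \<times> A))"
      using insert.prems insert.hyps ortho
      by (intro insert.IH) (auto simp: inner_add_left)
    then have "trivial_group (relative_homology_group (p-1) (top_of_set ?S) ?T)"
      using cylinder_excision[OF b(1), of "p-1" C A S]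
      by (meson group_relative_homology_group is_isoI isomorphic_group_triviality)
    then have triv: "trivial_group (relative_homology_group (p-1) (subtopology ?X ?S) ?T)"
      by (simp only: subtopology_cylinder)
    show ?case
      by (rule trivial_group_if_inj_on[OF group_homomorphism_hom_relboundary inj triv]) simp_all
  qed
qed

lemma inj_on_infinite_cyclic:
  assumes "group_hom H K g" and q: "q \<in> carrier H"
    and H: "pow H q \<in> iso integer_group H" and K: "pow K (g q) \<in> iso integer_group K"
  shows "inj_on g (carrier H)"
proof (rule inj_onI)
  interpret g: group_hom H K g by fact
  fix x y assume xy: "x \<in> carrier H" "y \<in> carrier H" "g x = g y"
  have "carrier H = range (pow H q :: int \<Rightarrow> _)" "inj (pow K (g q) :: int \<Rightarrow> _)"
    using H K by (simp_all add: iso_def bij_betw_def)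
  then obtain m n :: int where mn: "x = pow H q m" "y = pow H q n"
    using xy by blast
  then have "pow K (g q) m = pow K (g q) n"
    using xy(3) q by (simp add: g.hom_int_pow)
  then show "x = y"
    using \<open>inj (pow K (g q) :: int \<Rightarrow> _)\<close> mn by (auto dest: injD)
qed

lemma inj_on_conj_iso:
  assumes "i \<in> iso A B" "i' \<in> iso A' B'" "inj_on f (carrier A)" "f ` carrier A \<subseteq> carrier A'"
    and "\<And>z. z \<in> carrier A \<Longrightarrow> i' (f z) = g (i z)"
  shows "inj_on g (carrier B)"
proof -
  have "carrier B = i ` carrier A" "inj_on i' (carrier A')"
    using assms(1,2) by (auto simp: iso_def bij_betw_def)
  moreover have "inj_on (\<lambda>z. i' (f z)) (carrier A)"
    using assms(3,4) \<open>inj_on i' (carrier A')\<close> by (auto simp: inj_on_def image_subset_iff)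
  then have "inj_on (g \<circ> i) (carrier A)"
    using assms(5) by (simp add: inj_on_def)
  ultimately show ?thesis
    by (simp add: inj_on_imageI)
qed

text \<open>
  The zeroth homology of a path-connected space is infinite cyclic, generated by a point. Composing with the map to a
  one-point space sends this generator to a generator, so the composite is injective, and hence so is the
  first factor.
\<close>

lemma inj_on_hom_induced_zeroth:
  assumes X: "path_connected_space X" and f: "continuous_map X Y f"
  shows "inj_on (hom_induced 0 X {} Y {} f) (carrier (homology_group 0 X))"
proof (cases "topspace X = {}")
  case True
  then have "trivial_group (homology_group 0 X)"
    by (rule trivial_homology_group_empty)
  then show ?thesis
    by (simp add: trivial_group_def)
next
  case False
  let ?u = "\<lambda>x::'b. ()" and ?pt = "discrete_topology {()}"
  obtain a where a: "a \<in> topspace X"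
    using False by blast
  let ?\<sigma> = "restrict (\<lambda>x. a) (standard_simplex 0)" and ?H = "homology_group 0 X" and ?K = "homology_group 0 ?pt"
  let ?\<tau> = "simplex_map 0 (?u \<circ> f) ?\<sigma>"
  let ?g = "hom_induced 0 X {} ?pt {} (?u \<circ> f)"
  have \<sigma>: "singular_simplex 0 X ?\<sigma>"
    by (simp add: singular_simplex_def a)
  have uf: "continuous_map X ?pt (?u \<circ> f)"
    by auto
  have \<tau>: "singular_simplex 0 ?pt ?\<tau>"
    by (rule singular_simplex_simplex_map[OF \<sigma> uf])
  define q where "q = homologous_rel_set 0 X {} (frag_of ?\<sigma>)"
  define r where "r = homologous_rel_set 0 ?pt {} (frag_of ?\<tau>)"
  have iso: "pow ?H q \<in> iso integer_group ?H"
    unfolding q_def by (rule iso_integer_zeroth_homology_group[OF X \<sigma>])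
  have iso': "pow ?K r \<in> iso integer_group ?K"
    unfolding r_def by (rule iso_integer_zeroth_homology_group[OF _ \<tau>]) (metis path_connectedin_singleton path_connectedin_topspace
          topspace_discrete_topology insertI1)
  have rel\<sigma>: "singular_relcycle 0 X {} (frag_of ?\<sigma>)"
    using \<sigma> by (simp add: singular_cycle singular_chain_of chain_boundary_of)
  have gq: "?g q = r"
    unfolding q_def r_def using hom_induced_chain_map[OF uf _ rel\<sigma>, of "{}"] by simp
  have q: "q \<in> carrier ?H"
    unfolding q_def using rel\<sigma> by (auto simp: carrier_relative_homology_group_0)
  interpret g: group_hom ?H ?K ?g
    by (simp add: group_hom_def group_hom_axioms_def hom_induced_hom)
  have "inj_on ?g (carrier ?H)"
    by (rule inj_on_infinite_cyclic[OF g.group_hom_axioms q iso]) (simp only: gq iso')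
  moreover have "?g = hom_induced 0 Y {} ?pt {} ?u \<circ> hom_induced 0 X {} Y {} f"
    by (rule hom_induced_compose_empty[OF f]) auto
  ultimately show ?thesis
    by (simp add: inj_on_imageI2)
qed

text \<open>
  In the lowest degree in which \<open>trivial_cylinder\<close> leaves any homology, the homology comes from \<open>H\<^sub>0(A)\<close>. It is therefore
  not affected by a map out of a path-connected \<open>A\<close>. The boundary map of the triple and the excision isomorphism are
  natural, so each suspension step reduces the claim to the previous one, down to degree \<open>0\<close>.
\<close>

lemma inj_on_hom_induced_cylinder:
  fixes C :: "'b::euclidean_space set" and A :: "'a::topological_space set" and A' :: "'c::topological_space set"
  assumes "S \<subseteq> Basis" "\<And>x b r. \<lbrakk>x \<in> C; b \<in> S\<rbrakk> \<Longrightarrow> x + r *\<^sub>R b \<in> C" "p \<le> int (card S)"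
    and "convex C" and A: "path_connected A" and f: "continuous_on A f" "f ` A \<subseteq> A'"
  shows "inj_on (hom_induced p (top_of_set (C \<times> A)) ((C \<inter> off_perp S) \<times> A)
                    (top_of_set (C \<times> A')) ((C \<inter> off_perp S) \<times> A') (map_prod id f))
           (carrier (relative_homology_group p (top_of_set (C \<times> A)) ((C \<inter> off_perp S) \<times> A)))"
proof -
  have cont: "continuous_on (D \<times> A) (map_prod id f)" for D :: "'b set"
    unfolding map_prod_def case_prod_unfold
    by (auto intro!: continuous_intros continuous_on_compose2[OF f(1)])
  have "finite S"
    using assms(1) finite_Basis finite_subset by blast
  then show ?thesis
    using assms(1-4)
  proof (induction S arbitrary: C p)
    case empty
    have off_perp: "off_perp {} = {}"
      by (simp add: off_perp_def)
    show ?case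
    proof (cases "p = 0")
      case True
      have "path_connected (C \<times> A)"
        using empty A by (simp add: path_connected_Times convex_imp_path_connected)
      then have "path_connected_space (top_of_set (C \<times> A))"
        by simp
      moreover have "continuous_map (top_of_set (C \<times> A)) (top_of_set (C \<times> A')) (map_prod id f)"
        using cont f(2) by auto
      ultimately have "inj_on (hom_induced 0 (top_of_set (C \<times> A)) {} (top_of_set (C \<times> A')) {} (map_prod id f))
          (carrier (homology_group 0 (top_of_set (C \<times> A))))"
        by (rule inj_on_hom_induced_zeroth)
      then show ?thesis
        by (simp only: off_perp True Int_empty_right Sigma_empty1)
    next
      case False
      then have "trivial_group (relative_homology_group p (top_of_set (C \<times> A)) ((C \<inter> off_perp {}) \<times> A))"
        using empty by simp
      then show ?thesis
        by (simp add: trivial_group_def)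
    qed
  next
    case (insert b S)
    let ?X = "\<lambda>A. top_of_set (C \<times> A)" and ?S = "\<lambda>A. (C \<inter> off_perp (insert b S)) \<times> A"
      and ?T = "\<lambda>A. (C \<inter> (off_perp S \<union> {x. x \<bullet> b < 0})) \<times> A"
    let ?P = "C \<inter> {x. 0 < x \<bullet> b}"
    let ?f = "map_prod id f :: 'b \<times> 'a \<Rightarrow> 'b \<times> 'c"
    let ?Q = "\<lambda>A. top_of_set (?P \<times> A)" and ?R = "\<lambda>A. (?P \<inter> off_perp S) \<times> A"
    have b: "b \<in> Basis" "S \<subseteq> Basis"
      using insert by auto
    have ortho: "c \<bullet> b = 0" if "c \<in> S" for c
      using that b insert.hyps by (metis inner_not_same_Basis subsetD)
    have "?T A \<subseteq> ?S A"
      by (auto simp: off_perp_def)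
    then have inj: "inj_on (hom_relboundary p (?X A) (?S A) (?T A)) (carrier (relative_homology_group p (?X A) (?S A)))"
      by (intro inj_on_hom_relboundary trivial_cylinder_lower_half) (use insert in auto)
    have IH: "inj_on (hom_induced (p-1) (?Q A) (?R A) (?Q A') (?R A') ?f)
           (carrier (relative_homology_group (p-1) (?Q A) (?R A)))"
      using insert.prems insert.hyps ortho
      by (intro insert.IH) (auto simp: inner_add_left intro!: convex_Int convex_halfspace_gt[of 0 b, simplified inner_commute])
    let ?i = "hom_induced (p-1) (?Q A) (?R A) (top_of_set (?S A)) (?T A) id"
    let ?i' = "hom_induced (p-1) (?Q A') (?R A') (top_of_set (?S A')) (?T A') id"
    let ?d = "hom_relboundary p (?X A) (?S A) (?T A)"
    let ?d' = "hom_relboundary p (?X A') (?S A') (?T A')"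
    let ?F = "hom_induced p (?X A) (?S A) (?X A') (?S A') ?f"
    let ?FS = "hom_induced (p-1) (top_of_set (?S A)) (?T A) (top_of_set (?S A')) (?T A') ?f"
    let ?FP = "hom_induced (p-1) (?Q A) (?R A) (?Q A') (?R A') ?f"
    have i: "?i \<in> iso (relative_homology_group (p-1) (?Q A) (?R A)) (relative_homology_group (p-1) (top_of_set (?S A)) (?T A))"
      and i': "?i' \<in> iso (relative_homology_group (p-1) (?Q A') (?R A')) (relative_homology_group (p-1) (top_of_set (?S A')) (?T A'))"
      by (rule cylinder_excision[OF b(1)])+
    have "continuous_map (?X A) (?X A') ?f" "?f \<in> ?S A \<rightarrow> ?S A'" "?f \<in> ?T A \<rightarrow> ?T A'"
      using cont f(2) by auto
    then have nat1: "?d' \<circ> ?F = ?FS \<circ> ?d"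
      by (rule naturality_hom_induced_relboundary[of "?X A" "?X A'" ?f "?S A" "?S A'" "?T A" "?T A'" p,
            unfolded subtopology_cylinder])
    have nat2: "?i' (?FP z) = ?FS (?i z)" for z
    proof -
      have 1: "continuous_map (?Q A) (top_of_set (?S A)) id" "continuous_map (?Q A') (top_of_set (?S A')) id"
        by (auto simp: off_perp_def)
      have 2: "continuous_map (?Q A) (?Q A') ?f" "continuous_map (top_of_set (?S A)) (top_of_set (?S A')) ?f"
        using cont f(2) by auto
      have 3: "id \<in> ?R A \<rightarrow> ?T A" "id \<in> ?R A' \<rightarrow> ?T A'" "?f \<in> ?R A \<rightarrow> ?R A'" "?f \<in> ?T A \<rightarrow> ?T A'"
        using f(2) by auto
      show ?thesis
        using hom_induced_compose'[OF 2(1) 3(3) 1(2) 3(2), of "p-1" z]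
              hom_induced_compose'[OF 1(1) 3(1) 2(2) 3(4), of "p-1" z] by simp
    qed
    have injFS: "inj_on ?FS (carrier (relative_homology_group (p-1) (top_of_set (?S A)) (?T A)))"
      by (rule inj_on_conj_iso[OF i i' IH]) (use hom_induced_carrier nat2 in blast)+
    have "?d z \<in> carrier (relative_homology_group (p-1) (top_of_set (?S A)) (?T A))" for z
      using hom_relboundary[of p "?X A" "?S A" "?T A" z] by (simp only: subtopology_cylinder)
    then have "inj_on (?FS \<circ> ?d) (carrier (relative_homology_group p (?X A) (?S A)))"
      by (intro comp_inj_on[OF inj] inj_on_subset[OF injFS]) blast
    then show ?case
      unfolding nat1[symmetric] by (rule inj_on_imageI2)
  qed
qed

section \<open>Pairs of independent vectors\<close>

text \<open>
  Up to homotopy this is the Stiefel manifold of orthonormal pairs; independence is an open condition and is preserved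
  by all the deformations used below, which orthonormality is not.
\<close>

definition frames :: "('v::euclidean_space \<times> 'v) set" where
  "frames = {(x, y). \<forall>a b. a *\<^sub>R x + b *\<^sub>R y = 0 \<longrightarrow> a = 0 \<and> b = 0}"

lemma framesD:
  assumes "(x, y) \<in> frames" "a *\<^sub>R x + b *\<^sub>R y = 0"
  shows "a = 0" "b = 0"
  using assms by (auto simp: frames_def)

lemma frames_nonzero: "(x, y) \<in> frames \<Longrightarrow> x \<noteq> 0"
  using framesD(1)[of x y 1 0] by auto

text \<open>
  The complement of the closed ray of nonpositive multiples of \<open>(1, 0)\<close>.
\<close>

definition off_ray :: "(real \<times> 'b::euclidean_space) set" where
  "off_ray = {x. snd x \<noteq> 0 \<or> 0 < fst x}"

abbreviation frames_off_ray :: "((real \<times> 'b::euclidean_space) \<times> (real \<times> 'b)) set" where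
  "frames_off_ray \<equiv> {z \<in> frames. fst z \<in> off_ray}"

abbreviation (input) cross_axes :: "(real \<times> 'b::euclidean_space) set" where
  "cross_axes \<equiv> {0} \<times> Basis"

lemma off_cross_axes: "off_perp cross_axes = {x :: real \<times> 'b::euclidean_space. snd x \<noteq> 0}"
proof -
  have "(\<exists>b\<in>Basis. v \<bullet> b \<noteq> 0) \<longleftrightarrow> v \<noteq> 0" for v :: 'b
    using euclidean_all_zero_iff[of v] by blast
  then show ?thesis
    by (auto simp: off_perp_def inner_prod_def)
qed

lemma subtopology_frames_off_ray:
  "subtopology (top_of_set frames) frames_off_ray = top_of_set (frames_off_ray :: ((real \<times> 'b::euclidean_space) \<times> _) set)"
proof -
  have "frames \<inter> frames_off_ray = (frames_off_ray :: ((real \<times> 'b) \<times> _) set)"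
    by auto
  then show ?thesis
    by (simp only: subtopology_subtopology)
qed

lemma open_off_ray: "open (off_ray :: (real \<times> 'b::euclidean_space) set)"
proof -
  have eq: "off_ray = {x :: real \<times> 'b. snd x \<noteq> 0} \<union> {x. 0 < fst x}"
    by (auto simp: off_ray_def)
  show ?thesis
    unfolding eq by (intro open_Un open_Collect_neq open_Collect_less continuous_intros)
qed

text \<open>
  Where the first coordinate of \<open>x\<close> does not vanish, subtracting from \<open>y\<close> the multiple of \<open>x\<close> with the same first
  coordinate leaves a vector of the cross section \<open>'b\<close>, and independence means that it is nonzero. This trivializes
  the space of frames over a half space.
\<close>

lemma frames_left_iff:
  assumes "fst x < 0"
  shows "(x, y) \<in> frames \<longleftrightarrow> snd y - (fst y / fst x) *\<^sub>R snd x \<noteq> (0 :: 'b::euclidean_space)"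
proof
  assume xy: "(x, y) \<in> frames"
  show "snd y - (fst y / fst x) *\<^sub>R snd x \<noteq> 0"
  proof
    assume "snd y - (fst y / fst x) *\<^sub>R snd x = 0"
    then have "(- (fst y / fst x)) *\<^sub>R x + 1 *\<^sub>R y = 0"
      using assms by (simp add: prod_eq_iff)
    then show False
      using framesD(2)[OF xy] by fastforce
  qed
next
  assume ne: "snd y - (fst y / fst x) *\<^sub>R snd x \<noteq> 0"
  have "a = 0 \<and> b = 0" if "a *\<^sub>R x + b *\<^sub>R y = 0" for a b
  proof -
    have 1: "a * fst x + b * fst y = 0" and 2: "a *\<^sub>R snd x + b *\<^sub>R snd y = 0"
      using that by (simp_all add: prod_eq_iff)
    have a: "a = - b * (fst y / fst x)"
      using 1 assms by (simp add: field_simps)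
    have "b *\<^sub>R (snd y - (fst y / fst x) *\<^sub>R snd x) = 0"
      using 2 unfolding a by (simp add: algebra_simps)
    then have "b = 0"
      using ne by simp
    then show ?thesis
      using a by simp
  qed
  then show "(x, y) \<in> frames"
    by (auto simp: frames_def)
qed

definition left_half :: "(real \<times> 'b::euclidean_space) set" where
  "left_half = {x. fst x < 0}"

abbreviation left_frames :: "((real \<times> 'b::euclidean_space) \<times> (real \<times> 'b)) set" where
  "left_frames \<equiv> {z \<in> frames. fst z \<in> left_half}"

abbreviation left_frames_off :: "((real \<times> 'b::euclidean_space) \<times> (real \<times> 'b)) set" where
  "left_frames_off \<equiv> {z \<in> frames. fst z \<in> left_half \<inter> off_perp cross_axes}"

abbreviation (input) cross_vectors :: "(real \<times> 'b::euclidean_space) set" where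
  "cross_vectors \<equiv> UNIV \<times> (- {0})"

text \<open>
  The ray lies in the left half space, apart from the origin, which is not in the base. So the pair can be computed
  over the left half space alone, where it is trivial by \<open>trivialization\<close>.
\<close>

lemma excise_right_frames:
  "hom_induced p (top_of_set (left_frames :: ((real \<times> 'b::euclidean_space) \<times> _) set)) left_frames_off (top_of_set frames) frames_off_ray id
     \<in> iso (relative_homology_group p (top_of_set left_frames) left_frames_off)
           (relative_homology_group p (top_of_set frames) frames_off_ray)"
proof -
  let ?X = "top_of_set (frames :: ((real \<times> 'b) \<times> _) set)" and ?U = "{z \<in> frames. 0 \<le> fst (fst z)} :: ((real \<times> 'b) \<times> _) set"
  have "openin ?X frames_off_ray"
    unfolding openin_open by (rule exI[of _ "off_ray \<times> UNIV"]) (auto intro: open_Times open_off_ray)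
  moreover have "closedin ?X ?U"
    unfolding closedin_closed
    by (rule exI[of _ "{z. 0 \<le> fst (fst z)}"]) (auto intro!: closed_Collect_le continuous_intros)
  moreover have "?U \<subseteq> frames_off_ray"
    by (auto dest: frames_nonzero simp: off_ray_def prod_eq_iff less_eq_real_def)
  ultimately have "hom_induced p (subtopology ?X (topspace ?X - ?U)) (frames_off_ray - ?U) ?X frames_off_ray id
     \<in> iso (relative_homology_group p (subtopology ?X (topspace ?X - ?U)) (frames_off_ray - ?U))
           (relative_homology_group p ?X frames_off_ray)"
    by (rule excision_of_closed)
  moreover have "frames_off_ray - ?U = left_frames_off" "frames \<inter> (frames - ?U) = left_frames"
    unfolding off_cross_axes by (auto simp: off_ray_def left_half_def)
  ultimately show ?thesis
    by (simp only: topspace_subtopology topspace_euclidean Int_UNIV_left subtopology_subtopology)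
qed

lemma excise_right_half:
  "hom_induced p (top_of_set (left_half :: (real \<times> 'b::euclidean_space) set)) (left_half \<inter> off_perp cross_axes) (top_of_set (- {0})) off_ray id
     \<in> iso (relative_homology_group p (top_of_set left_half) (left_half \<inter> off_perp cross_axes))
           (relative_homology_group p (top_of_set (- {0})) off_ray)"
proof -
  let ?X = "top_of_set (- {0} :: (real \<times> 'b) set)" and ?U = "{z. z \<noteq> 0 \<and> 0 \<le> fst z} :: (real \<times> 'b) set"
  have "openin ?X off_ray"
    unfolding openin_open by (intro exI[of _ "off_ray"] conjI open_off_ray) (auto simp: off_ray_def)
  moreover have "closedin ?X ?U"
    unfolding closedin_closed
    by (rule exI[of _ "{z. 0 \<le> fst z}"]) (auto intro!: closed_Collect_le continuous_intros)
  moreover have "?U \<subseteq> off_ray"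
    by (auto simp: off_ray_def prod_eq_iff less_eq_real_def)
  ultimately have "hom_induced p (subtopology ?X (topspace ?X - ?U)) (off_ray - ?U) ?X off_ray id
     \<in> iso (relative_homology_group p (subtopology ?X (topspace ?X - ?U)) (off_ray - ?U))
           (relative_homology_group p ?X off_ray)"
    by (rule excision_of_closed)
  moreover have "off_ray - ?U = left_half \<inter> off_perp cross_axes" "- {0} \<inter> (- {0} - ?U) = left_half"
    unfolding off_cross_axes by (auto simp: off_ray_def left_half_def prod_eq_iff)
  ultimately show ?thesis
    by (simp only: topspace_subtopology topspace_euclidean Int_UNIV_left subtopology_subtopology)
qed

definition trivialize :: "(real \<times> 'b::euclidean_space) \<times> (real \<times> 'b) \<Rightarrow> (real \<times> 'b) \<times> (real \<times> 'b)" where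
  "trivialize = (\<lambda>(x, y). (x, fst y, snd y - (fst y / fst x) *\<^sub>R snd x))"

lemma trivialization:
  obtains g where "homeomorphic_maps (top_of_set (left_frames :: ((real \<times> 'b::euclidean_space) \<times> _) set))
     (top_of_set (left_half \<times> cross_vectors)) trivialize g"
    "trivialize \<in> left_frames_off \<rightarrow> (left_half \<inter> off_perp cross_axes) \<times> (cross_vectors :: (real \<times> 'b) set)"
    "g \<in> (left_half \<inter> off_perp cross_axes) \<times> (cross_vectors :: (real \<times> 'b) set) \<rightarrow> (left_frames_off :: ((real \<times> 'b) \<times> _) set)"
proof -
  define g :: "(real \<times> 'b) \<times> (real \<times> 'b) \<Rightarrow> _" where
    "g = (\<lambda>(x, v). (x, fst v, snd v + (fst v / fst x) *\<^sub>R snd x))"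
  have tr: "trivialize z \<in> left_half \<times> cross_vectors" "fst (trivialize z) = fst z"
    if "z \<in> left_frames" for z :: "(real \<times> 'b) \<times> (real \<times> 'b)"
    using that frames_left_iff[of "fst z" "snd z"] by (auto simp: trivialize_def left_half_def case_prod_beta)
  have g: "g z \<in> left_frames" "fst (g z) = fst z"
    if "z \<in> left_half \<times> cross_vectors" for z
    using that frames_left_iff[of "fst z" "snd (g z)"] by (auto simp: g_def left_half_def case_prod_beta)
  have "continuous_on left_frames (trivialize :: (real \<times> 'b) \<times> _ \<Rightarrow> _)"
    unfolding trivialize_def case_prod_unfold by (intro continuous_intros) (auto simp: left_half_def)
  moreover have "continuous_on (left_half \<times> cross_vectors) g"
    unfolding g_def case_prod_unfold by (intro continuous_intros) (auto simp: left_half_def)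
  moreover have "g (trivialize z) = z" "trivialize (g z) = z" for z
    by (simp_all add: g_def trivialize_def split: prod.splits)
  ultimately have "homeomorphic_maps (top_of_set left_frames) (top_of_set (left_half \<times> cross_vectors)) trivialize g"
    unfolding homeomorphic_maps_def using tr(1) g(1) by auto
  moreover have "trivialize \<in> left_frames_off \<rightarrow> (left_half \<inter> off_perp cross_axes) \<times> (cross_vectors :: (real \<times> 'b) set)"
    using tr by (fastforce simp: mem_Times_iff)
  moreover have "g \<in> (left_half \<inter> off_perp cross_axes) \<times> (cross_vectors :: (real \<times> 'b) set) \<rightarrow> left_frames_off"
    using g by (fastforce simp: mem_Times_iff)
  ultimately show ?thesis
    by (rule that)
qed

lemma left_half_translate: "x \<in> left_half \<Longrightarrow> b \<in> cross_axes \<Longrightarrow> x + r *\<^sub>R b \<in> left_half"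
  by (auto simp: left_half_def)

lemma cross_axes_Basis: "cross_axes \<subseteq> (Basis :: (real \<times> 'b::euclidean_space) set)"
  by (auto simp: Basis_prod_def)

lemma card_cross_axes: "card (cross_axes :: (real \<times> 'b::euclidean_space) set) = DIM('b)"
  by (simp add: card_cartesian_product)

lemma iso_trivialize:
  "hom_induced p (top_of_set left_frames) left_frames_off
      (top_of_set (left_half \<times> cross_vectors)) ((left_half \<inter> off_perp cross_axes) \<times> (cross_vectors :: (real \<times> 'b) set)) trivialize
   \<in> iso (relative_homology_group p (top_of_set (left_frames :: ((real \<times> 'b::euclidean_space) \<times> _) set)) left_frames_off)
         (relative_homology_group p (top_of_set (left_half \<times> cross_vectors)) ((left_half \<inter> off_perp cross_axes) \<times> cross_vectors))"
proof -
  obtain g where "homeomorphic_maps (top_of_set (left_frames :: ((real \<times> 'b) \<times> _) set))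
     (top_of_set (left_half \<times> cross_vectors)) trivialize g"
    "trivialize \<in> left_frames_off \<rightarrow> (left_half \<inter> off_perp cross_axes) \<times> (cross_vectors :: (real \<times> 'b) set)"
    "g \<in> (left_half \<inter> off_perp cross_axes) \<times> (cross_vectors :: (real \<times> 'b) set) \<rightarrow> (left_frames_off :: ((real \<times> 'b) \<times> _) set)"
    by (rule trivialization)
  then show ?thesis
    by (blast intro: group_isomorphisms_imp_iso homeomorphic_maps_relative_homology_group_isomorphisms)
qed

lemma trivial_frames_rel:
  assumes "p < int DIM('b)"
  shows "trivial_group (relative_homology_group p (top_of_set frames) (frames_off_ray :: ((real \<times> 'b::euclidean_space) \<times> _) set))"
proof -
  have "trivial_group (relative_homology_group p (top_of_set (left_half \<times> cross_vectors))
      (((left_half :: (real \<times> 'b) set) \<inter> off_perp cross_axes) \<times> (cross_vectors :: (real \<times> 'b) set)))" (is "trivial_group ?G")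
    using assms by (intro trivial_cylinder cross_axes_Basis left_half_translate) (auto simp: card_cross_axes)
  then have "trivial_group (relative_homology_group p (top_of_set left_frames) (left_frames_off :: ((real \<times> 'b) \<times> _) set))"
    by (rule isomorphic_group_triviality[OF is_isoI[OF iso_trivialize] group_relative_homology_group
          group_relative_homology_group, THEN iffD2])
  then show ?thesis
    by (rule isomorphic_group_triviality[OF is_isoI[OF excise_right_frames] group_relative_homology_group
          group_relative_homology_group, THEN iffD1])
qed

text \<open>
  Over the left half space the projection becomes the projection of \<open>C \<times> A\<close> to \<open>C\<close>. The factor \<open>A\<close> is
  path-connected because a space of dimension at least two remains so when a point is removed; thus
  \<open>inj_on_hom_induced_cylinder\<close> applies, with the one-point space as \<open>A'\<close>.
\<close>

lemma inj_on_frames_projection: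
  assumes "2 \<le> DIM('b)" "p \<le> int DIM('b)"
  shows "inj_on (hom_induced p (top_of_set frames) frames_off_ray (top_of_set (- {0})) off_ray fst)
    (carrier (relative_homology_group p (top_of_set frames) (frames_off_ray :: ((real \<times> 'b::euclidean_space) \<times> _) set)))"
proof -
  let ?D = "left_half \<inter> off_perp cross_axes :: (real \<times> 'b) set" and ?A = "cross_vectors :: (real \<times> 'b) set"
  let ?M = "top_of_set (left_frames :: ((real \<times> 'b) \<times> _) set)" and ?C = "top_of_set (left_half :: (real \<times> 'b) set)"
  let ?k = "\<lambda>x :: real \<times> 'b. (x, 0 :: real)"
  let ?pr = "map_prod id (\<lambda>_. 0) :: (real \<times> 'b) \<times> (real \<times> 'b) \<Rightarrow> (real \<times> 'b) \<times> real"
  have "convex (left_half :: (real \<times> 'b) set)"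
  proof -
    have eq: "left_half = {x :: real \<times> 'b. (1, 0) \<bullet> x < 0}"
      by (auto simp: left_half_def inner_prod_def)
    show ?thesis
      unfolding eq by (rule convex_halfspace_lt)
  qed
  moreover have "path_connected ?A"
    using assms(1) by (intro path_connected_Times path_connected_punctured_universe) auto
  ultimately have "inj_on (hom_induced p (top_of_set (left_half \<times> ?A)) (?D \<times> ?A)
      (top_of_set (left_half \<times> {0})) (?D \<times> {0}) ?pr)
      (carrier (relative_homology_group p (top_of_set (left_half \<times> ?A)) (?D \<times> ?A)))"
    using assms(2) by (intro inj_on_hom_induced_cylinder cross_axes_Basis left_half_translate) (auto simp: card_cross_axes)
  moreover have "hom_induced p ?M left_frames_off (top_of_set (left_half \<times> ?A)) (?D \<times> ?A) trivialize
      \<in> iso (relative_homology_group p ?M left_frames_off) (relative_homology_group p (top_of_set (left_half \<times> ?A)) (?D \<times> ?A))"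
    by (rule iso_trivialize)
  ultimately have "inj_on (hom_induced p (top_of_set (left_half \<times> ?A)) (?D \<times> ?A) (top_of_set (left_half \<times> {0})) (?D \<times> {0}) ?pr
      \<circ> hom_induced p ?M left_frames_off (top_of_set (left_half \<times> ?A)) (?D \<times> ?A) trivialize)
     (carrier (relative_homology_group p ?M left_frames_off))"
    by (intro comp_inj_on) (auto simp: iso_def bij_betw_def)
  moreover
  obtain g where g: "homeomorphic_maps ?M (top_of_set (left_half \<times> ?A)) trivialize g"
    "trivialize \<in> left_frames_off \<rightarrow> ?D \<times> ?A"
    by (rule trivialization) blast
  have tr: "continuous_map ?M (top_of_set (left_half \<times> ?A)) trivialize"
    using g(1) by (simp add: homeomorphic_maps_def)
  have "hom_induced p (top_of_set (left_half \<times> ?A)) (?D \<times> ?A) (top_of_set (left_half \<times> {0})) (?D \<times> {0}) ?pr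
      \<circ> hom_induced p ?M left_frames_off (top_of_set (left_half \<times> ?A)) (?D \<times> ?A) trivialize
     = hom_induced p ?M left_frames_off (top_of_set (left_half \<times> {0})) (?D \<times> {0}) (?pr \<circ> trivialize)"
    by (rule hom_induced_compose[OF tr g(2), symmetric])
       (auto simp: map_prod_def case_prod_unfold intro!: continuous_intros)
  moreover have "?pr \<circ> trivialize = ?k \<circ> fst"
    by (auto simp: trivialize_def)
  moreover have "hom_induced p ?M left_frames_off (top_of_set (left_half \<times> {0})) (?D \<times> {0}) (?k \<circ> fst)
     = hom_induced p ?C ?D (top_of_set (left_half \<times> {0})) (?D \<times> {0}) ?k \<circ> hom_induced p ?M left_frames_off ?C ?D fst"
    by (rule hom_induced_compose) (auto intro!: continuous_intros)
  ultimately have "inj_on (hom_induced p ?C ?D (top_of_set (left_half \<times> {0})) (?D \<times> {0}) ?k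
      \<circ> hom_induced p ?M left_frames_off ?C ?D fst) (carrier (relative_homology_group p ?M left_frames_off))"
    by (simp only:)
  then have inj: "inj_on (hom_induced p ?M left_frames_off ?C ?D fst) (carrier (relative_homology_group p ?M left_frames_off))"
    by (rule inj_on_imageI2)
  have B: "off_ray \<subseteq> (- {0} :: (real \<times> 'b) set)" "?D \<subseteq> off_ray" "left_half \<subseteq> (- {0} :: (real \<times> 'b) set)"
    unfolding off_cross_axes by (auto simp: off_ray_def left_half_def)
  show ?thesis
  proof (rule inj_on_conj_iso[OF excise_right_frames excise_right_half inj])
    show "hom_induced p ?M left_frames_off ?C ?D fst ` carrier (relative_homology_group p ?M left_frames_off)
        \<subseteq> carrier (relative_homology_group p ?C ?D)"
      using hom_induced_carrier by blast
  next
    fix z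
    have 1: "continuous_map ?M ?C fst" "continuous_map ?C (top_of_set (- {0})) id"
      "continuous_map ?M (top_of_set frames) id" "continuous_map (top_of_set frames) (top_of_set (- {0} :: (real \<times> 'b) set)) fst"
      using B by (auto dest: frames_nonzero intro!: continuous_intros simp flip: zero_prod_def)
    have 2: "fst \<in> left_frames_off \<rightarrow> ?D" "id \<in> ?D \<rightarrow> off_ray" "id \<in> left_frames_off \<rightarrow> frames_off_ray"
      "fst \<in> frames_off_ray \<rightarrow> (off_ray :: (real \<times> 'b) set)"
      unfolding off_cross_axes by (auto simp: off_ray_def)
    show "hom_induced p ?C ?D (top_of_set (- {0})) off_ray id (hom_induced p ?M left_frames_off ?C ?D fst z) =
          hom_induced p (top_of_set frames) frames_off_ray (top_of_set (- {0})) off_ray fst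
            (hom_induced p ?M left_frames_off (top_of_set frames) frames_off_ray id z)"
      using hom_induced_compose'[OF 1(1) 2(1) 1(2) 2(2), of p z] hom_induced_compose'[OF 1(3) 2(3) 1(4) 2(4), of p z]
      by (simp only: id_comp comp_id)
  qed
qed


text \<open>
  The Euler class of the sphere bundle vanishes when there is a section. The section shows that the projection on relative
  homology is onto as well as injective; hence every relative class \<open>\<alpha>\<close> comes from the base through the
  section, and so does its boundary. But the base off the ray is star-shaped, so the boundary is zero there.
\<close>

lemma hom_boundary_frames_trivial:
  fixes J :: "(real \<times> 'b::euclidean_space) \<Rightarrow> real \<times> 'b"
  assumes "2 \<le> DIM('b)" and J: "continuous_on (- {0}) J" "\<And>x. x \<noteq> 0 \<Longrightarrow> (x, J x) \<in> frames"
    and \<alpha>: "\<alpha> \<in> carrier (relative_homology_group (int DIM('b)) (top_of_set frames) (frames_off_ray :: ((real \<times> 'b) \<times> _) set))"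
  shows "hom_boundary (int DIM('b)) (top_of_set frames) frames_off_ray \<alpha>
       = \<one>\<^bsub>homology_group (int DIM('b) - 1) (top_of_set (frames_off_ray :: ((real \<times> 'b) \<times> _) set))\<^esub>"
proof -
  let ?n = "int DIM('b)"
  let ?M = "top_of_set (frames :: ((real \<times> 'b) \<times> _) set)" and ?B = "top_of_set (- {0} :: (real \<times> 'b) set)"
  let ?s = "\<lambda>x. (x, J x)"
  let ?\<pi> = "hom_induced ?n ?M frames_off_ray ?B off_ray fst" and ?\<sigma> = "hom_induced ?n ?B off_ray ?M frames_off_ray ?s"
  have B: "(off_ray :: (real \<times> 'b) set) \<subseteq> - {0}"
    by (auto simp: off_ray_def)
  have s: "continuous_map ?B ?M ?s" "?s \<in> off_ray \<rightarrow> frames_off_ray"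
  proof -
    have "continuous_on (- {0}) ?s"
      using J(1) by (intro continuous_intros)
    then show "continuous_map ?B ?M ?s"
      using J(2) by (simp add: Pi_iff)
    show "?s \<in> off_ray \<rightarrow> frames_off_ray"
    proof
      fix x :: "real \<times> 'b" assume x: "x \<in> off_ray"
      then have "x \<noteq> 0"
        using B by blast
      then show "?s x \<in> frames_off_ray"
        using x J(2) by simp
    qed
  qed
  have \<pi>: "continuous_map ?M ?B fst" "fst \<in> frames_off_ray \<rightarrow> off_ray"
    by (auto dest: frames_nonzero intro!: continuous_intros simp flip: zero_prod_def)
  have "?\<pi> (?\<sigma> (?\<pi> \<alpha>)) = ?\<pi> \<alpha>"
    using hom_induced_compose'[OF s \<pi>, of ?n "?\<pi> \<alpha>"]
    by (simp add: comp_def hom_induced_id[unfolded id_def] hom_induced_carrier)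
  then have \<alpha>_eq: "\<alpha> = ?\<sigma> (?\<pi> \<alpha>)"
    by (intro inj_onD[OF inj_on_frames_projection[OF assms(1) order_refl] _ \<alpha> hom_induced_carrier]) (rule sym)
  \<comment> \<open>The segments from (1, 0) miss the ray.\<close>
  have "starlike (off_ray :: (real \<times> 'b) set)"
  proof -
    have "(1 - u) *\<^sub>R (1, 0) + u *\<^sub>R x \<in> off_ray" if "x \<in> off_ray" "0 \<le> u" "u \<le> 1" for u and x :: "real \<times> 'b"
      using that by (cases "u = 0") (auto simp: off_ray_def intro!: add_nonneg_pos)
    then show ?thesis
      unfolding starlike_def by (intro bexI[of _ "(1, 0)"]) (auto simp: closed_segment_def off_ray_def)
  qed
  then have "contractible_space (top_of_set (off_ray :: (real \<times> 'b) set))"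
    by (simp add: contractible_space_top_of_set starlike_imp_contractible)
  from trivial_reduced_homology_group_contractible_space[OF this, of "?n - 1"] assms(1)
  have "trivial_group (homology_group (?n - 1) (top_of_set (off_ray :: (real \<times> 'b) set)))"
    by (simp add: un_reduced_homology_group)
  moreover have B_eq: "subtopology ?B off_ray = top_of_set off_ray" "subtopology ?M frames_off_ray = top_of_set frames_off_ray"
    using B by (simp only: subtopology_subtopology Int_absorb1) (rule subtopology_frames_off_ray)
  ultimately have triv: "trivial_group (homology_group (?n - 1) (subtopology ?B off_ray))"
    by simp
  have "hom_boundary ?n ?M frames_off_ray \<alpha> = (hom_boundary ?n ?M frames_off_ray \<circ> ?\<sigma>) (?\<pi> \<alpha>)"
    using \<alpha>_eq by simp
  also have "\<dots> = hom_induced (?n - 1) (subtopology ?B off_ray) {} (subtopology ?M frames_off_ray) {} ?s (hom_boundary ?n ?B off_ray (?\<pi> \<alpha>))"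
    using naturality_hom_induced[OF s, of ?n] by simp
  also have "hom_boundary ?n ?B off_ray (?\<pi> \<alpha>) = \<one>\<^bsub>homology_group (?n - 1) (subtopology ?B off_ray)\<^esub>"
    using triv hom_boundary_carrier unfolding trivial_group_def by blast
  also have "hom_induced (?n - 1) (subtopology ?B off_ray) {} (subtopology ?M frames_off_ray) {} ?s \<dots>
      = \<one>\<^bsub>homology_group (?n - 1) (subtopology ?M frames_off_ray)\<^esub>"
    by (intro hom_one hom_induced_hom) auto
  finally show ?thesis
    by (simp only: B_eq)
qed

lemma iso_if_exact:
  assumes "i \<in> hom G H" "group G" "group H"
    and "d ` carrier A = kernel G H i" "\<And>a. a \<in> carrier A \<Longrightarrow> d a = \<one>\<^bsub>G\<^esub>"
    and "i ` carrier G = kernel H K j" "j \<in> hom H K" "trivial_group K"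
  shows "i \<in> iso G H"
proof -
  interpret i: group_hom G H i
    using assms(1-3) by (simp add: group_hom_def group_hom_axioms_def)
  have "kernel G H i \<subseteq> {\<one>\<^bsub>G\<^esub>}"
    unfolding assms(4)[symmetric] using assms(5) by blast
  then have "inj_on i (carrier G)"
    using i.inj_on_one_iff by (auto simp: kernel_def)
  moreover have "kernel H K j = carrier H"
    using assms(7,8) hom_in_carrier[OF assms(7)] by (auto simp: kernel_def trivial_group_def)
  ultimately show ?thesis
    using assms(1,6) by (simp add: iso_def bij_betw_def)
qed

lemma iso_frames_off_ray:
  fixes J :: "(real \<times> 'b::euclidean_space) \<Rightarrow> real \<times> 'b"
  assumes "2 \<le> DIM('b)" and J: "continuous_on (- {0}) J" "\<And>x. x \<noteq> 0 \<Longrightarrow> (x, J x) \<in> frames"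
    and p: "p < int DIM('b)"
  shows "hom_induced p (top_of_set frames_off_ray) {} (top_of_set frames) {} id
    \<in> iso (homology_group p (top_of_set (frames_off_ray :: ((real \<times> 'b) \<times> _) set))) (homology_group p (top_of_set frames))"
proof -
  let ?M = "top_of_set (frames :: ((real \<times> 'b) \<times> _) set)" and ?M' = "top_of_set (frames_off_ray :: ((real \<times> 'b) \<times> _) set)"
  let ?G = "homology_group p ?M'" and ?H = "homology_group p ?M" and ?i = "hom_induced p ?M' {} ?M {} id"
  have sub: "subtopology ?M frames_off_ray = ?M'"
    by (rule subtopology_frames_off_ray)
  have bd: "hom_boundary (p + 1) ?M frames_off_ray \<alpha> = \<one>\<^bsub>?G\<^esub>"
    if \<alpha>: "\<alpha> \<in> carrier (relative_homology_group (p + 1) ?M frames_off_ray)" for \<alpha>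
  proof (cases "p + 1 = int DIM('b)")
    case True
    then have p': "p = int DIM('b) - 1"
      by simp
    show ?thesis
      unfolding True unfolding p'
      by (rule hom_boundary_frames_trivial[OF assms(1) J \<alpha>[unfolded True]])
  next
    case False
    then have "trivial_group (relative_homology_group (p + 1) ?M frames_off_ray)"
      using p by (intro trivial_frames_rel) auto
    then have "\<alpha> = \<one>\<^bsub>relative_homology_group (p + 1) ?M frames_off_ray\<^esub>"
      using \<alpha> by (simp add: trivial_group_def)
    then show ?thesis
      using hom_one[OF hom_boundary_hom[of "p + 1" ?M frames_off_ray]] by (simp add: sub)
  qed
  show ?thesis
  proof (rule iso_if_exact)
    show "?i \<in> hom ?G ?H"
      by (rule hom_induced_hom)
    show "hom_boundary (p + 1) ?M frames_off_ray ` carrier (relative_homology_group (p + 1) ?M frames_off_ray) = kernel ?G ?H ?i"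
      using homology_exactness_axiom_2[of "p + 1" ?M frames_off_ray] unfolding sub by simp
    show "?i ` carrier ?G = kernel ?H (relative_homology_group p ?M frames_off_ray) (hom_induced p ?M {} ?M frames_off_ray id)"
      using homology_exactness_axiom_3[of p ?M frames_off_ray] unfolding sub by simp
    show "hom_induced p ?M {} ?M frames_off_ray id \<in> hom ?H (relative_homology_group p ?M frames_off_ray)"
      by (rule hom_induced_hom)
    show "trivial_group (relative_homology_group p ?M frames_off_ray)"
      by (rule trivial_frames_rel[OF p])
  qed (simp_all only: bd group_relative_homology_group)
qed

section \<open>The fibre of the space of frames\<close>

lemma frames_linear_image:
  assumes "linear T" and inj: "\<And>v. T v = 0 \<Longrightarrow> v = 0" and "(x, y) \<in> frames"
  shows "(T x, T y) \<in> frames"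
  unfolding frames_def
proof (clarify)
  fix a b assume "a *\<^sub>R T x + b *\<^sub>R T y = 0"
  then have "T (a *\<^sub>R x + b *\<^sub>R y) = 0"
    using assms(1) by (simp add: linear_add linear_scale)
  then show "a = 0 \<and> b = 0"
    using inj framesD[OF assms(3)] by blast
qed

lemma frames_shear:
  assumes "(x, y) \<in> frames" "d \<noteq> 0"
  shows "(x, d *\<^sub>R y - c *\<^sub>R x) \<in> frames"
  unfolding frames_def
proof (clarify)
  fix a b assume "a *\<^sub>R x + b *\<^sub>R (d *\<^sub>R y - c *\<^sub>R x) = 0"
  then have "(a - b * c) *\<^sub>R x + (b * d) *\<^sub>R y = 0"
    by (simp add: algebra_simps)
  from framesD[OF assms(1) this] show "a = 0 \<and> b = 0"
    using assms(2) by auto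
qed

text \<open>
  The denominator of \<open>turn_form\<close>; it vanishes precisely on the removed ray.
\<close>

lemma norm_plus_fst_pos:
  assumes "x \<in> off_ray"
  shows "0 < norm x + fst x"
proof (cases "0 < fst x")
  case True
  then show ?thesis
    by (simp add: add_nonneg_pos)
next
  case False
  then have "snd x \<noteq> 0"
    using assms by (simp add: off_ray_def)
  then have "(fst x)\<^sup>2 < (fst x)\<^sup>2 + (norm (snd x))\<^sup>2"
    by simp
  then have "\<bar>fst x\<bar> < norm x"
    unfolding norm_prod_def by (metis real_norm_def real_sqrt_abs real_sqrt_less_iff power2_abs)
  then show ?thesis
    by linarith
qed

text \<open>
  The deformation onto the fibre over \<open>e0\<close> moves \<open>x\<close> along a segment to \<open>e0\<close> and carries \<open>y\<close> along by a linear map that takes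
  \<open>x\<close> to the moving point. The map is \<open>v + t \<ell>(v) (e0 - x)\<close> for the linear form \<open>\<ell>\<close> given by the inner product
  with a multiple of \<open>x / norm x + e0\<close>, scaled so that \<open>\<ell>(x) = 1\<close>. Then \<open>\<ell>(e0) = 1 / norm x\<close> is positive, and the
  determinant \<open>1 - t + t \<ell>(e0)\<close> has no zero for \<open>t\<close> between \<open>0\<close> and \<open>1\<close>.
\<close>

definition e0 :: "real \<times> 'b::euclidean_space" where "e0 = (1, 0)"

definition turn_form :: "real \<times> 'b::euclidean_space \<Rightarrow> real \<times> 'b \<Rightarrow> real" where
  "turn_form x v = ((v \<bullet> x) / norm x + fst v) / (norm x + fst x)"

definition turn :: "real \<Rightarrow> real \<times> 'b::euclidean_space \<Rightarrow> real \<times> 'b \<Rightarrow> real \<times> 'b" where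
  "turn t x v = v + (t * turn_form x v) *\<^sub>R (e0 - x)"

lemma turn_form_linear: "turn_form x (v + w) = turn_form x v + turn_form x w" "turn_form x (r *\<^sub>R v) = r * turn_form x v"
  by (simp_all add: turn_form_def inner_add_left add_divide_distrib algebra_simps)

lemma linear_turn: "linear (turn t x)"
  by (rule linearI) (simp_all add: turn_def turn_form_linear algebra_simps)

lemma turn_form_self:
  fixes x :: "real \<times> 'a::euclidean_space"
  assumes "x \<in> off_ray"
  shows "turn_form x x = 1" "turn_form x e0 = 1 / norm x"
proof -
  have "norm x > 0"
    using assms by (auto simp: off_ray_def prod_eq_iff)
  then have "x \<bullet> x / norm x = norm x" "fst x / norm x + 1 = (norm x + fst x) / norm x"
    by (simp_all add: dot_square_norm power2_eq_square field_simps)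
  moreover have "e0 \<bullet> x = fst x" "fst (e0 :: real \<times> 'a) = 1"
    by (simp_all add: e0_def inner_prod_def)
  ultimately show "turn_form x x = 1" "turn_form x e0 = 1 / norm x"
    using norm_plus_fst_pos[OF assms] by (simp_all add: turn_form_def)
qed

lemma turn_self: "x \<in> off_ray \<Longrightarrow> turn t x x = (1 - t) *\<^sub>R x + t *\<^sub>R e0"
  by (simp add: turn_def turn_form_self algebra_simps)

lemma turn_injective:
  assumes x: "x \<in> off_ray" and t: "0 \<le> t" "t \<le> 1" and "turn t x v = 0"
  shows "v = 0"
proof -
  have pos: "norm x > 0"
    using x by (auto simp: off_ray_def prod_eq_iff)
  have "turn_form x (v + (t * turn_form x v) *\<^sub>R (e0 + (-1) *\<^sub>R x)) = 0"
    using assms(4) by (simp add: turn_def) (simp add: turn_form_def)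
  then have "turn_form x v * ((1 - t) + t / norm x) = 0"
    by (simp add: turn_form_linear turn_form_self[OF x] algebra_simps del: scaleR_minus_left scaleR_minus1_left)
  moreover have "(1 - t) + t / norm x > 0"
    using t pos by (cases "t = 1") (auto intro: add_pos_nonneg)
  ultimately have "turn_form x v = 0"
    by simp
  then show ?thesis
    using assms(4) by (simp add: turn_def)
qed

lemma off_ray_star:
  assumes "x \<in> off_ray" "0 \<le> t" "t \<le> 1"
  shows "(1 - t) *\<^sub>R x + t *\<^sub>R e0 \<in> off_ray"
  using assms by (cases "t = 1") (auto simp: off_ray_def e0_def intro: add_pos_nonneg)

lemma continuous_on_turn [continuous_intros]:
  fixes x y :: "'c::topological_space \<Rightarrow> real \<times> 'b::euclidean_space"
  assumes "continuous_on A t" "continuous_on A x" "continuous_on A y" "\<And>a. a \<in> A \<Longrightarrow> x a \<in> off_ray"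
  shows "continuous_on A (\<lambda>a. turn (t a) (x a) (y a))"
proof -
  have "norm (x a) \<noteq> 0" "norm (x a) + fst (x a) \<noteq> 0" if "a \<in> A" for a
    using assms(4)[OF that] norm_plus_fst_pos[OF assms(4)[OF that]] by (auto simp: off_ray_def)
  then show ?thesis
    unfolding turn_def turn_form_def using assms(1-3) by (intro continuous_intros) auto
qed

text \<open>
  The space of frames over the star-shaped base deforms to the fibre over \<open>e0\<close>, that is, to the vectors \<open>y\<close> off the line
  spanned by \<open>e0\<close>. The multiple of the moving first vector that is subtracted in \<open>H\<close> does not affect
  independence, and at time \<open>1\<close> it cancels the component of \<open>y\<close> along \<open>e0\<close>.
\<close>

lemma frames_off_ray_homotopy_equivalent:
  "top_of_set (frames_off_ray :: ((real \<times> 'b::euclidean_space) \<times> _) set) homotopy_equivalent_space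
     top_of_set (- {0} :: 'b set)"
proof -
  let ?M = "frames_off_ray :: ((real \<times> 'b::euclidean_space) \<times> _) set"
  define f where "f = (\<lambda>(x, y :: real \<times> 'b). snd (turn 1 x y))"
  define g where "g = (\<lambda>v :: 'b. (e0 :: real \<times> 'b, (0 :: real, v)))"
  define H where "H = (\<lambda>(t, x, y :: real \<times> 'b). let x' = (1 - t) *\<^sub>R x + t *\<^sub>R e0 in
    (x', turn t x y - (t * fst (turn 1 x y)) *\<^sub>R x'))"
  have e0: "e0 \<in> off_ray"
    by (simp add: e0_def off_ray_def)
  have turned: "((1 - t) *\<^sub>R x + t *\<^sub>R e0, turn t x y) \<in> frames" if "(x, y) \<in> ?M" "0 \<le> t" "t \<le> 1" for t x y
    using frames_linear_image[OF linear_turn[of t x], of x y] turn_injective[of x t] turn_self[of x t] that by auto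
  have fM: "f z \<noteq> 0" if "z \<in> ?M" for z
  proof -
    obtain x y where z: "z = (x, y)"
      by (cases z)
    have "(e0, turn 1 x y) \<in> frames"
      using turned[of x y 1] that z by simp
    then have "snd (turn 1 x y) \<noteq> 0"
      using framesD(2)[of e0 "turn 1 x y" "- fst (turn 1 x y)" 1] by (auto simp: e0_def prod_eq_iff)
    then show ?thesis
      by (simp add: f_def z)
  qed
  have gM: "g v \<in> ?M" if "v \<noteq> 0" for v
    using that e0 by (auto simp: g_def frames_def e0_def prod_eq_iff)
  have HM: "H (t, z) \<in> ?M" if "z \<in> ?M" "0 \<le> t" "t \<le> 1" for t z
  proof -
    obtain x y where z: "z = (x, y)"
      by (cases z)
    show ?thesis
      using frames_shear[OF turned[of x y t], of 1] off_ray_star[of x t] that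
      by (simp add: H_def z Let_def)
  qed
  have contf: "continuous_on ?M f"
    unfolding f_def case_prod_unfold
    by (intro continuous_intros) auto
  have contg: "continuous_on UNIV g"
    unfolding g_def by (intro continuous_intros)
  have contH: "continuous_on ({0..1} \<times> ?M) H"
    unfolding H_def case_prod_unfold Let_def by (intro continuous_intros) auto
  have fg: "f (g v) = v" for v
    by (simp add: f_def g_def turn_def)
  show ?thesis
    unfolding homotopy_equivalent_space_def
  proof (intro exI conjI)
    show "continuous_map (top_of_set ?M) (top_of_set (- {0})) f"
      using contf fM by auto
    show "continuous_map (top_of_set (- {0})) (top_of_set ?M) g"
      using continuous_on_subset[OF contg] gM by auto
    have "homotopic_with (\<lambda>x. True) (top_of_set ?M) (top_of_set ?M) id (g \<circ> f)"
    proof (rule homotopic_with_top_of_setI[OF contH])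
      fix z assume "z \<in> ?M"
      then show "H (0, z) = id z" "H (1, z) = (g \<circ> f) z"
        by (auto simp: H_def g_def f_def turn_def e0_def prod_eq_iff split: prod.splits)
    qed (use HM in auto)
    then show "homotopic_with (\<lambda>x. True) (top_of_set ?M) (top_of_set ?M) (g \<circ> f) id"
      by (rule homotopic_with_symD)
    show "homotopic_with (\<lambda>x. True) (top_of_set (- {0})) (top_of_set (- {0})) (f \<circ> g) id"
      by (rule homotopic_with_equal) (auto simp: fg)
  qed
qed

lemma punctured_homotopy_equivalent_nsphere:
  "top_of_set (- {0} :: 'b::euclidean_space set) homotopy_equivalent_space nsphere (DIM('b) - 1)"
proof -
  let ?S = "sphere (0 :: 'b) 1"
  have int: "interior (cball (0 :: 'b) 1) \<noteq> {}"
    by simp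
  have "rel_frontier (cball (0 :: 'b) 1) = ?S"
    unfolding rel_frontier_def rel_interior_nonempty_interior[OF int] by (simp add: cball_diff_eq_sphere)
  moreover have "affine hull (cball (0 :: 'b) 1) - {0} = - {0}"
    unfolding affine_hull_nonempty_interior[OF int] by auto
  moreover have "0 \<in> rel_interior (cball (0 :: 'b) 1)"
    unfolding rel_interior_nonempty_interior[OF int] by simp
  ultimately have "?S homotopy_eqv - {0 :: 'b}"
    using homotopy_eqv_rel_frontier_punctured_affine_hull[of "cball (0 :: 'b) 1" 0] by simp
  then have "top_of_set (- {0 :: 'b}) homotopy_equivalent_space top_of_set ?S"
    by (rule homotopy_equivalent_space_sym[THEN iffD1])
  moreover obtain f :: "(nat \<Rightarrow> real) \<Rightarrow> 'b" and g
    where "homeomorphic_maps (nsphere(DIM('b) - 1)) (top_of_set (sphere 0 1 \<inter> span Basis)) f g"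
    by (rule homeomorphic_maps_nsphere_euclidean_sphere[OF independent_Basis orthogonal_Basis refl])
       (auto simp: norm_Basis)
  then have "nsphere (DIM('b) - 1) homeomorphic_space top_of_set ?S"
    by (auto simp: homeomorphic_space_def)
  then have "top_of_set ?S homotopy_equivalent_space nsphere (DIM('b) - 1)"
    by (metis homeomorphic_imp_homotopy_equivalent_space homotopy_equivalent_space_sym)
  ultimately show ?thesis
    by (rule homotopy_eqv_trans)
qed


section \<open>The punctured implosion as a space of frames\<close>

definition i_times :: "complex ^ 3 \<Rightarrow> complex ^ 3" where
  "i_times v = (\<chi> k. \<i> * v $ k)"

definition cnj_vec :: "complex ^ 3 \<Rightarrow> complex ^ 3" where
  "cnj_vec v = (\<chi> k. cnj (v $ k))"

lemma linear_i_times: "linear i_times" and linear_cnj_vec: "linear cnj_vec"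
  by (auto simp: i_times_def cnj_vec_def vec_eq_iff linear_iff algebra_simps)

lemma continuous_on_i_times [continuous_intros]: "continuous_on S f \<Longrightarrow> continuous_on S (\<lambda>x. i_times (f x))"
  and continuous_on_cnj_vec [continuous_intros]: "continuous_on S f \<Longrightarrow> continuous_on S (\<lambda>x. cnj_vec (f x))"
  unfolding i_times_def cnj_vec_def by (intro continuous_intros; simp)+

lemma i_times_i_times [simp]: "i_times (i_times v) = - v"
  and cnj_vec_cnj_vec [simp]: "cnj_vec (cnj_vec v) = v"
  and i_times_simps: "i_times (v + w) = i_times v + i_times w" "i_times (r *\<^sub>R v) = r *\<^sub>R i_times v" "i_times (- v) = - i_times v"
     "i_times (v - w) = i_times v - i_times w"
  and cnj_vec_simps: "cnj_vec (v + w) = cnj_vec v + cnj_vec w" "cnj_vec (r *\<^sub>R v) = r *\<^sub>R cnj_vec v" "cnj_vec (- v) = - cnj_vec v"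
     "cnj_vec (v - w) = cnj_vec v - cnj_vec w"
  by (auto simp: i_times_def cnj_vec_def vec_eq_iff algebra_simps)

lemma frames_i_times:
  assumes "v \<noteq> 0"
  shows "(v, i_times v) \<in> frames"
  unfolding frames_def
proof clarify
  fix a b assume *: "a *\<^sub>R v + b *\<^sub>R i_times v = 0"
  have "(complex_of_real a + \<i> * complex_of_real b) * v $ k = (a *\<^sub>R v + b *\<^sub>R i_times v) $ k" for k
    unfolding vector_add_component vector_scaleR_component i_times_def vec_lambda_beta scaleR_conv_of_real[where 'a = complex]
    by (simp add: algebra_simps)
  then have "(complex_of_real a + \<i> * complex_of_real b) * v $ k = 0" for k
    by (simp add: *)
  moreover obtain k where "v $ k \<noteq> 0"
    using assms by (auto simp: vec_eq_iff)
  ultimately have "complex_of_real a + \<i> * complex_of_real b = 0"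
    by (metis mult_eq_0_iff)
  then show "a = 0 \<and> b = 0"
    by (simp add: complex_eq_iff)
qed

definition punctured_implosion :: "((complex ^ 3) \<times> (complex ^ 3)) set" where
  "punctured_implosion = SU3_implosion - {0}"

text \<open>
  In the coordinates \<open>(z\<^sub>k + w\<^sub>k) / 2\<close> and \<open>(z\<^sub>k - w\<^sub>k) / (2i)\<close> the form \<open>z \<cdot> w\<close> is the sum of six squares. The real
  and imaginary parts of these six complex coordinates are two vectors of \<open>\<real>\<^sup>6\<close>. Identified with \<open>\<complex>\<^sup>3\<close> and
  doubled they are \<open>z + cnj w\<close> and \<open>- i (z - cnj w)\<close>.
\<close>

definition real_part :: "(complex ^ 3) \<times> (complex ^ 3) \<Rightarrow> complex ^ 3" where
  "real_part = (\<lambda>(z, w). z + cnj_vec w)"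

definition imag_part :: "(complex ^ 3) \<times> (complex ^ 3) \<Rightarrow> complex ^ 3" where
  "imag_part = (\<lambda>(z, w). i_times (cnj_vec w - z))"

definition from_parts :: "complex ^ 3 \<Rightarrow> complex ^ 3 \<Rightarrow> (complex ^ 3) \<times> (complex ^ 3)" where
  "from_parts p q = ((1/2) *\<^sub>R (p + i_times q), (1/2) *\<^sub>R cnj_vec (p - i_times q))"

lemma from_parts_parts [simp]: "from_parts (real_part u) (imag_part u) = u"
  by (simp add: from_parts_def real_part_def imag_part_def i_times_simps cnj_vec_simps split: prod.splits flip: scaleR_2)

lemma parts_from_parts [simp]: "real_part (from_parts p q) = p" "imag_part (from_parts p q) = q"
  by (simp_all add: from_parts_def real_part_def imag_part_def i_times_simps cnj_vec_simps vec_eq_iff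
      scaleR_conv_of_real[where 'a = complex] algebra_simps)

text \<open>
  For complex numbers \<open>x + iy\<close> the sum of squares has real part \<open>\<bar>x\<bar>\<^sup>2 - \<bar>y\<bar>\<^sup>2\<close> and imaginary part \<open>2 x \<bullet> y\<close>; the
  factors \<open>4\<close> and \<open>2\<close> come from the doubling in \<open>real_part\<close> and \<open>imag_part\<close>.
\<close>

lemma bilinear_form_parts:
  "4 * Re (\<Sum>k\<in>UNIV. z $ k * w $ k) = real_part (z, w) \<bullet> real_part (z, w) - imag_part (z, w) \<bullet> imag_part (z, w)"
  "2 * Im (\<Sum>k\<in>UNIV. z $ k * w $ k) = real_part (z, w) \<bullet> imag_part (z, w)"
proof -
  have "4 * Re (z $ k * w $ k) = (real_part (z, w) $ k) \<bullet> (real_part (z, w) $ k) - (imag_part (z, w) $ k) \<bullet> (imag_part (z, w) $ k)"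
    and "2 * Im (z $ k * w $ k) = (real_part (z, w) $ k) \<bullet> (imag_part (z, w) $ k)" for k
    by (simp_all add: real_part_def imag_part_def i_times_def cnj_vec_def inner_complex_def algebra_simps)
  then show "4 * Re (\<Sum>k\<in>UNIV. z $ k * w $ k) = real_part (z, w) \<bullet> real_part (z, w) - imag_part (z, w) \<bullet> imag_part (z, w)"
    "2 * Im (\<Sum>k\<in>UNIV. z $ k * w $ k) = real_part (z, w) \<bullet> imag_part (z, w)"
    by (simp_all add: inner_vec_def sum_distrib_left sum_subtractf del: times_complex.sel)
qed

lemma mem_SU3_implosion_iff:
  "u \<in> SU3_implosion \<longleftrightarrow> norm (real_part u) = norm (imag_part u) \<and> real_part u \<bullet> imag_part u = 0"
proof (cases u)
  case (Pair z w)
  have "u \<in> SU3_implosion \<longleftrightarrow> Re (\<Sum>k\<in>UNIV. z $ k * w $ k) = 0 \<and> Im (\<Sum>k\<in>UNIV. z $ k * w $ k) = 0"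
    by (simp add: SU3_implosion_def Pair complex_eq_iff del: Re_sum Im_sum)
  also have "\<dots> \<longleftrightarrow> real_part u \<bullet> real_part u = imag_part u \<bullet> imag_part u \<and> real_part u \<bullet> imag_part u = 0"
    using bilinear_form_parts[of z w] unfolding Pair by linarith
  finally show ?thesis
    by (simp add: norm_eq)
qed

lemma parts_zero_iff: "real_part u = 0 \<and> imag_part u = 0 \<longleftrightarrow> u = 0"
proof -
  have "from_parts 0 0 = 0"
    using linear_0[OF linear_i_times] linear_0[OF linear_cnj_vec] by (simp add: from_parts_def zero_prod_def)
  moreover have "real_part 0 = 0" "imag_part 0 = 0"
    using linear_0[OF linear_i_times] linear_0[OF linear_cnj_vec] by (auto simp: real_part_def imag_part_def zero_prod_def)
  ultimately show ?thesis
    by (metis from_parts_parts)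
qed

lemma mem_punctured_implosion_iff:
  "u \<in> punctured_implosion \<longleftrightarrow> real_part u \<noteq> 0 \<and> norm (real_part u) = norm (imag_part u) \<and> real_part u \<bullet> imag_part u = 0"
  unfolding punctured_implosion_def using parts_zero_iff[of u] by (auto simp: mem_SU3_implosion_iff)

definition gram_schmidt :: "'v::euclidean_space \<Rightarrow> 'v \<Rightarrow> 'v" where
  "gram_schmidt x y = y - ((x \<bullet> y) / (x \<bullet> x)) *\<^sub>R x"

lemma gram_schmidt_nonzero: "(x, y) \<in> frames \<Longrightarrow> gram_schmidt x y \<noteq> 0"
  using framesD(2)[of x y "- ((x \<bullet> y) / (x \<bullet> x))" 1] by (auto simp: gram_schmidt_def)

lemma gram_schmidt_orthogonal: "x \<bullet> gram_schmidt x y = 0"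
  by (cases "x = 0") (simp_all add: gram_schmidt_def inner_diff_right)

lemma orthogonal_frames:
  assumes "x \<noteq> 0" "y \<noteq> 0" "x \<bullet> y = (0 :: real)"
  shows "(x, y) \<in> frames"
  unfolding frames_def
proof clarify
  fix a b assume *: "a *\<^sub>R x + b *\<^sub>R y = 0"
  have "x \<bullet> (a *\<^sub>R x + b *\<^sub>R y) = 0" "y \<bullet> (a *\<^sub>R x + b *\<^sub>R y) = 0"
    using * by simp_all
  then show "a = 0 \<and> b = 0"
    using assms by (simp add: inner_add_right inner_commute)
qed

text \<open>
  Gram--Schmidt, followed by rescaling to the length of the first vector, retracts the independent pairs onto the orthogonal
  pairs of equal length. The straight segment from the new second vector to the old one consists of positive multiples
  of the old one modulo the first vector, so the pair stays independent along it.
\<close>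

lemma punctured_implosion_homotopy_equivalent_frames:
  "top_of_set punctured_implosion homotopy_equivalent_space top_of_set (frames :: ((complex ^ 3) \<times> (complex ^ 3)) set)"
proof -
  define f where "f = (\<lambda>u. (real_part u, imag_part u))"
  define r where "r = (\<lambda>(x, y :: complex ^ 3). (norm x / norm (gram_schmidt x y)) *\<^sub>R gram_schmidt x y)"
  define g where "g = (\<lambda>z. from_parts (fst z) (r z))"
  define H where "H = (\<lambda>(t :: real, z). (fst z, (1 - t) *\<^sub>R r z + t *\<^sub>R snd z))"
  have f: "f u \<in> frames" if "u \<in> punctured_implosion" for u
    using that unfolding f_def mem_punctured_implosion_iff by (intro orthogonal_frames) auto
  have g: "g z \<in> punctured_implosion" if "z \<in> frames" for z
    using that gram_schmidt_nonzero[of "fst z" "snd z"] frames_nonzero[of "fst z" "snd z"]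
    by (auto simp: mem_punctured_implosion_iff g_def r_def case_prod_beta gram_schmidt_orthogonal)
  have gf: "g (f u) = u" if "u \<in> punctured_implosion" for u
  proof -
    have "norm (imag_part u) \<noteq> 0" "norm (real_part u) = norm (imag_part u)" "real_part u \<bullet> imag_part u = 0"
      using that unfolding mem_punctured_implosion_iff by auto
    then show ?thesis
      by (simp add: g_def f_def r_def gram_schmidt_def)
  qed
  have H: "H (t, z) \<in> frames" if "z \<in> frames" "0 \<le> t" "t \<le> 1" for t z
  proof -
    obtain x y where z: "z = (x, y)"
      by (cases z)
    define l where "l = norm x / norm (gram_schmidt x y)"
    have "l > 0"
      using that gram_schmidt_nonzero[of x y] frames_nonzero[of x y] by (simp add: l_def z)
    then have "(1 - t) * l + t \<noteq> 0"
      using that by (cases "t = 0") (auto simp: add_nonneg_pos order_less_imp_not_eq2)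
    moreover have "H (t, z) = (x, ((1 - t) * l + t) *\<^sub>R y - ((1 - t) * l * ((x \<bullet> y) / (x \<bullet> x))) *\<^sub>R x)"
      by (simp add: H_def z r_def l_def[symmetric]) (simp add: gram_schmidt_def algebra_simps)
    ultimately show ?thesis
      using frames_shear[of x y] that(1) z by simp
  qed
  have contr: "continuous_on frames r"
  proof -
    have "z \<in> frames \<Longrightarrow> norm (gram_schmidt (fst z) (snd z)) \<noteq> 0 \<and> fst z \<bullet> fst z \<noteq> 0" for z :: "(complex ^ 3) \<times> (complex ^ 3)"
      using gram_schmidt_nonzero[of "fst z" "snd z"] frames_nonzero[of "fst z" "snd z"] by auto
    then show ?thesis
      unfolding r_def gram_schmidt_def case_prod_unfold by (intro continuous_intros) auto
  qed
  show ?thesis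
    unfolding homotopy_equivalent_space_def
  proof (intro exI conjI)
    have "continuous_on punctured_implosion f"
      unfolding f_def real_part_def imag_part_def case_prod_unfold by (intro continuous_intros)
    then show "continuous_map (top_of_set punctured_implosion) (top_of_set frames) f"
      using f by auto
    have "continuous_on frames g"
      unfolding g_def from_parts_def by (intro continuous_intros contr)
    then show "continuous_map (top_of_set frames) (top_of_set punctured_implosion) g"
      using g by auto
    show "homotopic_with (\<lambda>x. True) (top_of_set punctured_implosion) (top_of_set punctured_implosion) (g \<circ> f) id"
      by (rule homotopic_with_equal)
         (use gf \<open>continuous_map (top_of_set punctured_implosion) (top_of_set frames) f\<close>
           \<open>continuous_map (top_of_set frames) (top_of_set punctured_implosion) g\<close> in \<open>auto intro: continuous_map_compose\<close>)
    show "homotopic_with (\<lambda>x. True) (top_of_set frames) (top_of_set frames) (f \<circ> g) id"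
    proof (rule homotopic_with_top_of_setI)
      show "continuous_on ({0..1} \<times> frames) H"
        unfolding H_def case_prod_unfold
        by (intro continuous_intros continuous_on_compose2[OF contr]) auto
    qed (use H in \<open>auto simp: H_def f_def g_def\<close>)
  qed
qed


section \<open>Integral homology of the punctured implosion\<close>

text \<open>
  The linear map \<open>J\<close> provides a section. An even-dimensional \<open>'v\<close> has one, namely a complex structure.
\<close>

lemma homology_group_frames_sphere:
  fixes J :: "'v::euclidean_space \<Rightarrow> 'v"
  assumes dim: "DIM('v) = DIM('b::euclidean_space) + 1" "2 \<le> DIM('b)"
    and J: "linear J" "\<And>v. v \<noteq> 0 \<Longrightarrow> (v, J v) \<in> frames" and p: "p < int DIM('b)"
  shows "homology_group p (top_of_set (frames :: ('v \<times> 'v) set)) \<cong> homology_group p (nsphere (DIM('b) - 1))"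
proof -
  have "dim (UNIV :: 'v set) = dim (UNIV :: (real \<times> 'b) set)"
    by (simp add: dim)
  then obtain T :: "'v \<Rightarrow> real \<times> 'b" and T' where T: "linear T" "linear T'"
    and inv: "\<And>x. T' (T x) = x" "\<And>y. T (T' y) = y"
    by (rule isometries_subspaces[OF subspace_UNIV subspace_UNIV]) auto
  have T0: "T v = 0 \<Longrightarrow> v = 0" "T' w = 0 \<Longrightarrow> w = 0" for v w
    using inv T by (metis linear_0)+
  have cont: "continuous_on UNIV T" "continuous_on UNIV T'" "continuous_on UNIV J"
    using T J by (simp_all add: linear_continuous_on linear_conv_bounded_linear)
  let ?M = "frames :: ('v \<times> 'v) set" and ?M' = "frames :: ((real \<times> 'b) \<times> _) set"
  have "homeomorphic_maps (top_of_set ?M) (top_of_set ?M') (map_prod T T) (map_prod T' T')"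
    unfolding homeomorphic_maps_def
    using frames_linear_image[OF T(1) T0(1)] frames_linear_image[OF T(2) T0(2)]
    by (auto simp: inv map_prod_def case_prod_unfold
        intro!: continuous_intros continuous_on_compose2[OF cont(1)] continuous_on_compose2[OF cont(2)])
  then have "top_of_set ?M homeomorphic_space top_of_set ?M'"
    by (auto simp: homeomorphic_space_def)
  then have "homology_group p (top_of_set ?M) \<cong> homology_group p (top_of_set ?M')"
    by (rule homeomorphic_space_imp_isomorphic_homology_groups)
  also have "\<dots> \<cong> homology_group p (top_of_set (frames_off_ray :: ((real \<times> 'b) \<times> _) set))"
  proof -
    let ?J = "\<lambda>x. T (J (T' x))"
    have 1: "continuous_on (- {0}) ?J"
      by (intro continuous_on_compose2[OF cont(1)] continuous_on_compose2[OF cont(3)] continuous_on_subset[OF cont(2)]) auto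
    have 2: "(x, ?J x) \<in> frames" if "x \<noteq> 0" for x
    proof -
      have "T' x \<noteq> 0"
        using T0(2) that by blast
      from frames_linear_image[OF T(1) T0(1) J(2)[OF this]] show ?thesis
        by (simp add: inv)
    qed
    show ?thesis
      using iso_frames_off_ray[OF dim(2) 1 2 p] by (meson group.iso_sym group_relative_homology_group is_isoI)
  qed
  also have "\<dots> \<cong> homology_group p (nsphere (DIM('b) - 1))"
    using homotopy_eqv_trans[OF frames_off_ray_homotopy_equivalent punctured_homotopy_equivalent_nsphere]
    by (rule homotopy_equivalent_space_imp_isomorphic_homology_groups)
  finally show ?thesis .
qed

lemma homology_group_punctured_implosion_nsphere:
  assumes "p \<le> 4"
  shows "homology_group p (top_of_set punctured_implosion) \<cong> homology_group p (nsphere 4)"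
proof -
  have "homology_group p (top_of_set punctured_implosion) \<cong> homology_group p (top_of_set (frames :: ((complex ^ 3) \<times> _) set))"
    by (rule homotopy_equivalent_space_imp_isomorphic_homology_groups[OF punctured_implosion_homotopy_equivalent_frames])
  also have "\<dots> \<cong> homology_group p (nsphere (DIM(real ^ 5) - 1))"
    using assms by (intro homology_group_frames_sphere[OF _ _ linear_i_times frames_i_times]) auto
  finally show ?thesis
    by simp
qed

lemma trivial_homology_group_punctured_implosion:
  assumes "p \<in> {1, 2, 3}"
  shows "trivial_group (homology_group p (top_of_set punctured_implosion))"
proof -
  have "trivial_group (homology_group p (nsphere 4))"
    using assms reduced_homology_group_nsphere(2)[of p 4] by (auto simp: un_reduced_homology_group)
  then show ?thesis
    using isomorphic_group_triviality[OF homology_group_punctured_implosion_nsphere[of p]] assms by auto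
qed

lemma homology_group_punctured_implosion:
  assumes "p \<in> {0, 4}"
  shows "homology_group p (top_of_set punctured_implosion) \<cong> integer_group"
proof -
  let ?A = "top_of_set (- {0} :: (real ^ 5) set)"
  have "path_connected_space ?A"
    by (simp add: path_connected_punctured_universe)
  then have "homology_group 0 ?A \<cong> integer_group"
    by (rule isomorphic_integer_zeroth_homology_group) auto
  moreover have "?A homotopy_equivalent_space nsphere 4"
    using punctured_homotopy_equivalent_nsphere[where 'b = "real ^ 5"] by simp
  then have "homology_group 0 ?A \<cong> homology_group 0 (nsphere 4)"
    by (rule homotopy_equivalent_space_imp_isomorphic_homology_groups)
  ultimately have "homology_group 0 (nsphere 4) \<cong> integer_group"
    by (meson group.iso_sym group_relative_homology_group iso_trans)
  moreover have "homology_group 4 (nsphere 4) \<cong> integer_group"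
    using reduced_homology_group_nsphere(1)[of 4] by (simp add: un_reduced_homology_group)
  ultimately show ?thesis
    using assms homology_group_punctured_implosion_nsphere[of p] by (auto intro: iso_trans)
qed

section \<open>From integral to real coefficients\<close>

lemma lookup_scaleR [simp]: "Poly_Mapping.lookup (r *\<^sub>R c) x = r *\<^sub>R Poly_Mapping.lookup c x"
  by (simp add: scaleR_poly_mapping.rep_eq)

lemma keys_scaleR: "Poly_Mapping.keys (r *\<^sub>R c) \<subseteq> Poly_Mapping.keys c"
  by (auto simp: in_keys_iff)

lemma lookup_map_zero [simp]: "f 0 = 0 \<Longrightarrow> Poly_Mapping.lookup (Poly_Mapping.map f c) x = f (Poly_Mapping.lookup c x)"
  by (simp add: Poly_Mapping.map.rep_eq when_def)

lemma keys_map_subset: "Poly_Mapping.keys (Poly_Mapping.map f c) \<subseteq> Poly_Mapping.keys c"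
  by (auto simp: in_keys_iff Poly_Mapping.map.rep_eq when_def)

text \<open>
  Both boundary operators are given by the same integral matrix, whose entries are the coefficients of
  \<open>chain_boundary i (frag_of \<sigma>)\<close>. This is what makes additive maps of the coefficients commute with the boundary.
\<close>

lemma lookup_chain_boundary:
  assumes "finite S" "Poly_Mapping.keys z \<subseteq> S"
  shows "Poly_Mapping.lookup (chain_boundary i z) \<tau>
       = (\<Sum>\<sigma>\<in>S. Poly_Mapping.lookup z \<sigma> * Poly_Mapping.lookup (chain_boundary i (frag_of \<sigma>)) \<tau>)"
proof (cases "i = 0")
  case True
  then show ?thesis
    by (simp add: chain_boundary_def)
next
  case False
  then have "chain_boundary i z = (\<Sum>\<sigma>\<in>Poly_Mapping.keys z. frag_cmul (Poly_Mapping.lookup z \<sigma>) (chain_boundary i (frag_of \<sigma>)))"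
    by (simp add: chain_boundary_def frag_extend_def)
  then show ?thesis
    using assms by (auto simp: lookup_sum in_keys_iff intro!: sum.mono_neutral_left)
qed

lemma lookup_real_chain_boundary:
  assumes "finite S" "Poly_Mapping.keys c \<subseteq> S"
  shows "Poly_Mapping.lookup (real_chain_boundary i c) \<tau>
       = (\<Sum>\<sigma>\<in>S. Poly_Mapping.lookup c \<sigma> * real_of_int (Poly_Mapping.lookup (chain_boundary i (frag_of \<sigma>)) \<tau>))"
proof (cases "i = 0")
  case True
  then show ?thesis
    by (simp add: chain_boundary_def real_chain_boundary_def)
next
  case False
  have "real_of_int (Poly_Mapping.lookup (chain_boundary i (frag_of \<sigma>)) \<tau>)
      = (\<Sum>k\<le>i. (-1) ^ k * (if singular_face i k \<sigma> = \<tau> then 1 else 0))" for \<sigma>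
    using False by (auto simp: chain_boundary_of lookup_sum lookup_single when_def intro!: sum.cong)
  then have "Poly_Mapping.lookup (real_chain_boundary i c) \<tau>
       = (\<Sum>\<sigma>\<in>Poly_Mapping.keys c. Poly_Mapping.lookup c \<sigma> * real_of_int (Poly_Mapping.lookup (chain_boundary i (frag_of \<sigma>)) \<tau>))"
    using False
    by (auto simp: real_chain_boundary_def lookup_sum lookup_single when_def sum_distrib_left intro!: sum.cong)
  also have "\<dots> = (\<Sum>\<sigma>\<in>S. Poly_Mapping.lookup c \<sigma> * real_of_int (Poly_Mapping.lookup (chain_boundary i (frag_of \<sigma>)) \<tau>))"
    using assms by (intro sum.mono_neutral_left) (auto simp: in_keys_iff)
  finally show ?thesis .
qed

lemma linear_real_chain_boundary: "linear (real_chain_boundary i)"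
proof (rule linearI)
  fix c d :: "'a real_chain" and r :: real
  let ?S = "Poly_Mapping.keys c \<union> Poly_Mapping.keys d"
  have S: "finite ?S" "Poly_Mapping.keys c \<subseteq> ?S" "Poly_Mapping.keys d \<subseteq> ?S" "Poly_Mapping.keys (c + d) \<subseteq> ?S"
    "Poly_Mapping.keys (r *\<^sub>R c) \<subseteq> ?S"
    using keys_add[of c d] keys_scaleR[of r c] by auto
  show "real_chain_boundary i (c + d) = real_chain_boundary i c + real_chain_boundary i d"
    by (rule poly_mapping_eqI)
       (simp add: lookup_add lookup_real_chain_boundary[OF S(1,4)] lookup_real_chain_boundary[OF S(1,2)]
          lookup_real_chain_boundary[OF S(1,3)] sum.distrib algebra_simps)
  show "real_chain_boundary i (r *\<^sub>R c) = r *\<^sub>R real_chain_boundary i c"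
    by (rule poly_mapping_eqI)
       (simp add: lookup_real_chain_boundary[OF S(1,5)] lookup_real_chain_boundary[OF S(1,2)] sum_distrib_left mult.assoc)
qed

lemma additive_mult_int:
  fixes f :: "real \<Rightarrow> real"
  assumes "\<And>x y. f (x + y) = f x + f y"
  shows "f (x * real_of_int m) = f x * real_of_int m"
proof -
  have f0: "f 0 = 0"
    using assms[of 0 0] by simp
  show ?thesis
  proof (induction m rule: int_induct[of _ 0])
    case base
    then show ?case by (simp add: f0)
  next
    case (step1 m)
    then show ?case
      using assms[of "x * real_of_int m" x] by (simp add: algebra_simps)
  next
    case (step2 m)
    then show ?case
      using assms[of "x * real_of_int m - x" x] by (simp add: algebra_simps)
  qed
qed

lemma real_chain_boundary_map:
  assumes f: "\<And>x y. f (x + y) = f x + f y"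
  shows "real_chain_boundary i (Poly_Mapping.map f c) = Poly_Mapping.map f (real_chain_boundary i c)"
proof (rule poly_mapping_eqI)
  fix \<tau>
  let ?S = "Poly_Mapping.keys c"
  have f0: "f 0 = 0"
    using f[of 0 0] by simp
  have "f (sum g A) = (\<Sum>x\<in>A. f (g x))" for g :: "((nat \<Rightarrow> real) \<Rightarrow> 'a) \<Rightarrow> real" and A
    by (induction A rule: infinite_finite_induct) (auto simp: f f0)
  then show "Poly_Mapping.lookup (real_chain_boundary i (Poly_Mapping.map f c)) \<tau>
      = Poly_Mapping.lookup (Poly_Mapping.map f (real_chain_boundary i c)) \<tau>"
    by (simp add: f0 lookup_real_chain_boundary[of ?S] keys_map_subset additive_mult_int[of f, OF f])
qed

abbreviation of_int_chain :: "'a chain \<Rightarrow> 'a real_chain" where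
  "of_int_chain \<equiv> Poly_Mapping.map real_of_int"

lemma real_chain_boundary_of_int: "real_chain_boundary i (of_int_chain z) = of_int_chain (chain_boundary i z)"
  by (rule poly_mapping_eqI)
     (simp add: lookup_real_chain_boundary[of "Poly_Mapping.keys z"] lookup_chain_boundary[of "Poly_Mapping.keys z"] keys_map_subset)

lemma keys_of_int_chain [simp]: "Poly_Mapping.keys (of_int_chain z) = Poly_Mapping.keys z"
  by (auto simp: in_keys_iff)

lemma of_int_chain_eq_iff [simp]: "of_int_chain z = of_int_chain z' \<longleftrightarrow> z = z'"
  by (auto simp: poly_mapping_eq_iff fun_eq_iff)

lemma of_int_chain_0 [simp]: "of_int_chain 0 = 0"
  by (rule poly_mapping_eqI) simp

text \<open>
  Coordinates with respect to a Hamel basis of \<open>\<real>\<close> over \<open>\<rat>\<close>. Only finitely many basis vectors occur in the elements of \<open>R\<close>.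
\<close>

lemma rational_coordinates:
  assumes "finite (R :: real set)"
  shows "\<exists>(B :: real set) (f :: real \<Rightarrow> real \<Rightarrow> real). finite B \<and>
    (\<forall>b x y. f b (x + y) = f b x + f b y) \<and> (\<forall>b x. f b x \<in> \<rat>) \<and> (\<forall>r\<in>R. r = (\<Sum>b\<in>B. f b r * b))"
proof -
  interpret Q: vector_space "\<lambda>q::rat. \<lambda>x::real. of_rat q * x"
    by unfold_locales (simp_all add: algebra_simps of_rat_add of_rat_mult)
  let ?E = "Q.extend_basis {}"
  have ind: "Q.independent ?E" and span: "Q.span ?E = UNIV"
    using Q.independent_extend_basis[of "{}"] Q.span_extend_basis[of "{}"] by (simp_all add: Q.independent_empty)
  define f where "f = (\<lambda>b x. real_of_rat (Q.representation ?E x b))"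
  define B where "B = (\<Union>r\<in>R. {b. Q.representation ?E r b \<noteq> 0})"
  show ?thesis
  proof (intro exI conjI allI ballI)
    show "finite B"
      unfolding B_def using assms Q.finite_representation by blast
    show "f b (x + y) = f b x + f b y" for b x y
      unfolding f_def using Q.representation_add[OF ind, of x y] span by (simp add: of_rat_add add.commute)
    show "f b x \<in> \<rat>" for b x
      by (simp add: f_def)
    show "r = (\<Sum>b\<in>B. f b r * b)" if "r \<in> R" for r
    proof -
      have "r = (\<Sum>b | Q.representation ?E r b \<noteq> 0. f b r * b)"
        unfolding f_def using Q.sum_nonzero_representation_eq[OF ind, of r] span by simp
      also have "\<dots> = (\<Sum>b\<in>B. f b r * b)"
        using that \<open>finite B\<close> by (intro sum.mono_neutral_left) (auto simp: B_def f_def)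
      finally show ?thesis .
    qed
  qed
qed

lemma common_denominator:
  assumes "finite R" "R \<subseteq> (\<rat> :: real set)"
  shows "\<exists>N > 0. \<forall>r\<in>R. real N * r \<in> \<int>"
  using assms
  proof (induction R rule: finite_induct)
    case empty
    then show ?case by auto
  next
    case (insert q R)
    then obtain N where N: "N > 0" "\<forall>r\<in>R. real N * r \<in> \<int>"
      by auto
    obtain a b where ab: "b > 0" "q = real_of_int a / real_of_int b"
      using insert.prems by (meson Rats_cases' insert_subset)
    have "real (N * nat b) * r \<in> \<int>" if "r \<in> insert q R" for r
    proof (cases "r = q")
      case True
      then have "real (N * nat b) * r = of_int (int N * a)"
        using ab by simp
      then show ?thesis
        by (metis Ints_of_int)
    next
      case False
      then have "real (N * nat b) * r = (real N * r) * real (nat b)" "real N * r \<in> \<int>"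
        using that N(2) by simp_all
      then show ?thesis
        by (metis Ints_mult Ints_of_nat)
    qed
    then show ?case
      using N(1) ab(1) by (intro exI[of _ "N * nat b"]) simp
  qed

lemma rational_chain_denominator:
  fixes c :: "'a real_chain"
  assumes "\<And>\<sigma>. Poly_Mapping.lookup c \<sigma> \<in> \<rat>"
  shows "\<exists>N z. N > 0 \<and> real N *\<^sub>R c = of_int_chain z \<and> Poly_Mapping.keys z = Poly_Mapping.keys c"
proof -
  have "finite (Poly_Mapping.lookup c ` Poly_Mapping.keys c)" "Poly_Mapping.lookup c ` Poly_Mapping.keys c \<subseteq> \<rat>"
    using assms by auto
  then obtain N :: nat where N: "N > 0" "\<forall>r\<in>Poly_Mapping.lookup c ` Poly_Mapping.keys c. real N * r \<in> \<int>"
    using common_denominator by blast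
  define z where "z = Poly_Mapping.map (\<lambda>x. \<lfloor>real N * x\<rfloor>) c"
  have "real N * Poly_Mapping.lookup c \<sigma> = real_of_int (Poly_Mapping.lookup z \<sigma>)" for \<sigma>
  proof (cases "\<sigma> \<in> Poly_Mapping.keys c")
    case True
    then show ?thesis
      using N(2) by (simp add: z_def)
  qed (simp add: z_def in_keys_iff)
  then have eq: "real N *\<^sub>R c = of_int_chain z"
    by (intro poly_mapping_eqI) simp
  have "Poly_Mapping.keys (of_int_chain z) = Poly_Mapping.keys c"
    unfolding eq[symmetric] using N(1) by (auto simp: in_keys_iff)
  then show ?thesis
    using N(1) eq by (intro exI[of _ N] exI[of _ z]) simp
qed

definition real_singular_chain :: "nat \<Rightarrow> 'a topology \<Rightarrow> 'a real_chain \<Rightarrow> bool" where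
  "real_singular_chain p X c \<longleftrightarrow> Poly_Mapping.keys c \<subseteq> singular_simplex_set p X"

lemma real_singular_chain_of_int: "real_singular_chain p X (of_int_chain z) \<longleftrightarrow> singular_chain p X z"
  by (simp add: real_singular_chain_def singular_chain_def)

lemma real_singular_chain_add: "real_singular_chain p X c \<Longrightarrow> real_singular_chain p X d \<Longrightarrow> real_singular_chain p X (c + d)"
  using keys_add[of c d] by (auto simp: real_singular_chain_def)

lemma real_singular_chain_scaleR: "real_singular_chain p X c \<Longrightarrow> real_singular_chain p X (r *\<^sub>R c)"
  using keys_scaleR[of r c] by (auto simp: real_singular_chain_def)

lemma real_singular_chain_sum: "(\<And>b. b \<in> B \<Longrightarrow> real_singular_chain p X (c b)) \<Longrightarrow> real_singular_chain p X (\<Sum>b\<in>B. c b)"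
  by (induction B rule: infinite_finite_induct) (auto simp: real_singular_chain_add, simp_all add: real_singular_chain_def)

text \<open>
  Applying a rational coordinate function to all coefficients commutes with the boundary, so it turns a real cycle into
  a rational one, and clearing denominators makes the latter integral. The cycle is recovered from its
  coordinates.
\<close>

lemma real_cycle_decomposition:
  assumes "real_singular_chain p X c" "real_chain_boundary p c = 0"
  shows "\<exists>(B :: real set) z s. finite B \<and> (\<forall>b\<in>B. singular_relcycle p X {} (z b)) \<and>
    c = (\<Sum>b\<in>B. s b *\<^sub>R of_int_chain (z b))"
proof -
  obtain B and f :: "real \<Rightarrow> real \<Rightarrow> real" where B: "finite B"
    and add': "\<forall>b x y. f b (x + y) = f b x + f b y" and rat: "\<forall>b x. f b x \<in> \<rat>"
    and expand: "\<forall>r\<in>Poly_Mapping.lookup c ` Poly_Mapping.keys c. r = (\<Sum>b\<in>B. f b r * b)"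
    using rational_coordinates[OF finite_imageI[OF finite_keys, of "Poly_Mapping.lookup c" c]] by blast
  note add = add'[rule_format]
  have f0: "f b 0 = 0" for b
    using add[of b 0 0] by simp
  define cb where "cb b = Poly_Mapping.map (f b) c" for b
  have "\<exists>N z. N > 0 \<and> real N *\<^sub>R cb b = of_int_chain z \<and> Poly_Mapping.keys z = Poly_Mapping.keys (cb b)" for b
    using rat f0 by (intro rational_chain_denominator) (simp add: cb_def)
  then obtain N z where Nz: "\<And>b. N b > (0 :: nat)" "\<And>b. real (N b) *\<^sub>R cb b = of_int_chain (z b)"
    "\<And>b. Poly_Mapping.keys (z b) = Poly_Mapping.keys (cb b)"
    by metis
  have "singular_relcycle p X {} (z b)" for b
  proof -
    have "real_chain_boundary p (cb b) = 0"
      unfolding cb_def using real_chain_boundary_map[of "f b" p c, OF add] assms(2) f0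
      by (simp add: poly_mapping_eq_iff fun_eq_iff)
    then have "of_int_chain (chain_boundary p (z b)) = of_int_chain 0"
      by (simp add: Nz(2)[symmetric] linear_scale[OF linear_real_chain_boundary] flip: real_chain_boundary_of_int)
    then have "chain_boundary p (z b) = 0"
      by (simp only: of_int_chain_eq_iff)
    moreover have "singular_chain p X (z b)"
      using assms(1) keys_map_subset[of "f b" c] unfolding singular_chain_def real_singular_chain_def Nz(3) cb_def by blast
    ultimately show ?thesis
      by (simp add: singular_cycle)
  qed
  moreover have "c = (\<Sum>b\<in>B. (b / real (N b)) *\<^sub>R of_int_chain (z b))"
  proof (rule poly_mapping_eqI)
    fix \<sigma>
    have "(b / real (N b)) *\<^sub>R of_int_chain (z b) = b *\<^sub>R cb b" for b
      using Nz(1)[of b] by (simp flip: Nz(2))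
    then have "Poly_Mapping.lookup (\<Sum>b\<in>B. (b / real (N b)) *\<^sub>R of_int_chain (z b)) \<sigma> = (\<Sum>b\<in>B. f b (Poly_Mapping.lookup c \<sigma>) * b)"
      by (simp add: lookup_sum cb_def f0 mult.commute)
    also have "\<dots> = Poly_Mapping.lookup c \<sigma>"
      using expand by (cases "\<sigma> \<in> Poly_Mapping.keys c") (auto simp: in_keys_iff f0)
    finally show "Poly_Mapping.lookup c \<sigma> = Poly_Mapping.lookup (\<Sum>b\<in>B. (b / real (N b)) *\<^sub>R of_int_chain (z b)) \<sigma>"
      by simp
  qed
  ultimately show ?thesis
    using B by (intro exI conjI ballI)
qed

text \<open>
  A rational coordinate function that does not vanish at \<open>1\<close>, divided by its value there, is an additive map from \<open>\<real>\<close> to \<open>\<rat>\<close>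
  that fixes the integers. Applied to the coefficients of \<open>d\<close> it keeps the boundary \<open>z\<close>, so \<open>z\<close> bounds a rational
  chain, and a multiple of \<open>z\<close> bounds an integral one.
\<close>

lemma integral_multiple_bounds:
  assumes d: "real_singular_chain (Suc p) X d" "real_chain_boundary (Suc p) d = of_int_chain z"
  shows "\<exists>N > 0. singular_relboundary p X {} (frag_cmul (int N) z)"
proof -
  obtain B and f :: "real \<Rightarrow> real \<Rightarrow> real" where B: "finite B"
    and add: "\<forall>b x y. f b (x + y) = f b x + f b y" and rat: "\<forall>b x. f b x \<in> \<rat>"
    and expand: "\<forall>r\<in>{1}. r = (\<Sum>b\<in>B. f b r * b)"
    using rational_coordinates[of "{1}"] by blast
  have "(\<Sum>b\<in>B. f b 1 * b) \<noteq> 0"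
    using expand by simp
  then have "\<exists>b\<in>B. f b 1 \<noteq> 0"
    by (rule contrapos_np) simp
  then obtain b where b: "f b 1 \<noteq> 0"
    by blast
  \<comment> \<open>An additive retraction of the reals onto the rationals.\<close>
  define g where "g x = f b x / f b 1" for x
  have g: "g (x + y) = g x + g y" "g x \<in> \<rat>" for x y
    using add rat by (auto simp: g_def add_divide_distrib)
  have g0: "g 0 = 0"
    using g(1)[of 0 0] by simp
  have g_int: "g (real_of_int m) = real_of_int m" for m
    using additive_mult_int[of g 1 m, OF g(1)] b by (simp add: g_def)
  obtain N e where N: "N > 0" "real N *\<^sub>R Poly_Mapping.map g d = of_int_chain e" "Poly_Mapping.keys e = Poly_Mapping.keys (Poly_Mapping.map g d)"
  proof -
    have "Poly_Mapping.lookup (Poly_Mapping.map g d) \<sigma> \<in> \<rat>" for \<sigma>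
      using g(2) g0 by simp
    then show ?thesis
      using that rational_chain_denominator[of "Poly_Mapping.map g d"] by blast
  qed
  have "of_int_chain (chain_boundary (Suc p) e) = real N *\<^sub>R Poly_Mapping.map g (of_int_chain z)"
    using d(2) real_chain_boundary_map[of g "Suc p" d, OF g(1)]
    by (simp add: N(2)[symmetric] linear_scale[OF linear_real_chain_boundary] flip: real_chain_boundary_of_int)
  also have "\<dots> = of_int_chain (frag_cmul (int N) z)"
    by (rule poly_mapping_eqI) (simp add: g0 g_int)
  finally have "chain_boundary (Suc p) e = frag_cmul (int N) z"
    by (simp only: of_int_chain_eq_iff)
  moreover have "singular_chain (Suc p) X e"
    using d(1) keys_map_subset[of g d] unfolding singular_chain_def real_singular_chain_def N(3) by blast
  ultimately show ?thesis
    using N(1) by (auto simp: singular_boundary)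
qed

lemma trivial_homology_real_cycle_bounds:
  assumes triv: "trivial_group (homology_group (int p) X)"
    and c: "real_singular_chain p X c" "real_chain_boundary p c = 0"
  obtains d where "real_singular_chain (Suc p) X d" "real_chain_boundary (Suc p) d = c"
proof -
  obtain B :: "real set" and z s where B: "finite B" "\<forall>b\<in>B. singular_relcycle p X {} (z b)"
    and ceq: "c = (\<Sum>b\<in>B. s b *\<^sub>R of_int_chain (z b))"
    using real_cycle_decomposition[OF c] by blast
  have "singular_relboundary p X {} (z b)" if "b \<in> B" for b
  proof -
    have "homologous_rel_set p X {} (z b) \<in> carrier (homology_group (int p) X)"
      using B(2) that by (auto simp: carrier_relative_homology_group)
    then have "homologous_rel_set p X {} (z b) = singular_relboundary_set p X {}"
      using triv by (simp add: trivial_group_def)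
    then show ?thesis
      by (simp add: homologous_rel_set_eq_relboundary)
  qed
  then have "\<exists>d. singular_chain (Suc p) X d \<and> chain_boundary (Suc p) d = z b" if "b \<in> B" for b
    using that by (simp add: singular_boundary)
  then obtain d where d: "\<And>b. b \<in> B \<Longrightarrow> singular_chain (Suc p) X (d b) \<and> chain_boundary (Suc p) (d b) = z b"
    by metis
  show ?thesis
  proof (rule that[of "\<Sum>b\<in>B. s b *\<^sub>R of_int_chain (d b)"])
    show "real_singular_chain (Suc p) X (\<Sum>b\<in>B. s b *\<^sub>R of_int_chain (d b))"
      using d by (intro real_singular_chain_sum real_singular_chain_scaleR) (simp add: real_singular_chain_of_int)
    show "real_chain_boundary (Suc p) (\<Sum>b\<in>B. s b *\<^sub>R of_int_chain (d b)) = c"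
      using d by (simp add: ceq linear_sum[OF linear_real_chain_boundary] linear_scale[OF linear_real_chain_boundary]
          real_chain_boundary_of_int)
  qed
qed

lemma infinite_cyclic_homology_generator:
  assumes "homology_group (int p) X \<cong> integer_group"
  shows "\<exists>z. singular_relcycle p X {} z \<and>
    (\<forall>y. singular_relcycle p X {} y \<longrightarrow> (\<exists>n. homologous_rel p X {} y (frag_cmul n z))) \<and>
    (\<forall>n. singular_relboundary p X {} (frag_cmul n z) \<longrightarrow> n = 0)"
proof -
  let ?H = "homology_group (int p) X"
  have "integer_group \<cong> ?H"
    using assms group.iso_sym group_relative_homology_group by blast
  then obtain h where h: "h \<in> iso integer_group ?H"
    by (auto simp: is_iso_def)
  then have bij: "bij_betw h UNIV (carrier ?H)" and hom: "h \<in> hom integer_group ?H"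
    by (simp_all add: iso_def)
  have "h 1 \<in> carrier ?H"
    using bij by (auto simp: bij_betw_def)
  then obtain z where z: "singular_relcycle p X {} z" "h 1 = homologous_rel_set p X {} z"
    by (auto simp: carrier_relative_homology_group)
  interpret h: group_hom integer_group ?H h
    using hom by (simp add: group_hom_def group_hom_axioms_def)
  have h_eq: "h n = homologous_rel_set p X {} (frag_cmul n z)" for n
  proof -
    have "z \<in> carrier (subgroup_generated (free_Abelian_group (singular_simplex_set p X)) (singular_relcycle_set p X {}))"
      using z(1) by (metis carrier_relcycle_group chain_group_def mem_Collect_eq relcycle_group_def)
    moreover have "Poly_Mapping.keys z \<subseteq> singular_simplex_set p X"
      using z(1) by (simp add: singular_cycle singular_chain_def)
    ultimately have pow: "z [^]\<^bsub>relcycle_group p X {}\<^esub> n = frag_cmul n z"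
      by (simp add: relcycle_group_def chain_group_def group.int_pow_subgroup_generated)
    have "h n = h (pow integer_group 1 n)"
      by simp
    also have "\<dots> = pow ?H (h 1) n"
      by (rule h.hom_int_pow) simp
    also have "\<dots> = homologous_rel_set p X {} (z [^]\<^bsub>relcycle_group p X {}\<^esub> n)"
      unfolding z(2)
      by (rule subst[OF right_coset_singular_relboundary])
         (simp add: z(1) relative_homology_group_def normal.FactGroup_int_pow normal_subgroup_singular_relboundary_relcycle)
    finally show ?thesis
      by (simp only: pow)
  qed
  show ?thesis
  proof (intro exI[of _ z] conjI allI impI z(1))
    fix y assume "singular_relcycle p X {} y"
    then have "homologous_rel_set p X {} y \<in> h ` UNIV"
      using bij by (simp add: bij_betw_def carrier_relative_homology_group)
    then show "\<exists>n. homologous_rel p X {} y (frag_cmul n z)"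
      by (auto simp: h_eq homologous_rel_set_eq)
  next
    fix n assume "singular_relboundary p X {} (frag_cmul n z)"
    then have "h n = \<one>\<^bsub>?H\<^esub>"
      by (simp add: h_eq homologous_rel_set_eq_relboundary)
    then have "h n = h 0"
      using h.hom_one by simp
    then show "n = 0"
      using bij by (simp add: bij_betw_def inj_eq)
  qed
qed

text \<open>
  The integral generator still spans real homology because every real cycle is a real combination of integral cycles. It
  is not a boundary, as otherwise some multiple of it would bound an integral chain.
\<close>

lemma infinite_cyclic_homology_real_generator:
  assumes "homology_group (int p) X \<cong> integer_group"
  shows "\<exists>g. real_singular_chain p X g \<and> real_chain_boundary p g = 0 \<and>
    (\<forall>d. real_singular_chain (Suc p) X d \<longrightarrow> real_chain_boundary (Suc p) d \<noteq> g) \<and>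
    (\<forall>c. real_singular_chain p X c \<longrightarrow> real_chain_boundary p c = 0 \<longrightarrow>
       (\<exists>r d. real_singular_chain (Suc p) X d \<and> c = r *\<^sub>R g + real_chain_boundary (Suc p) d))"
proof -
  obtain z where z: "singular_relcycle p X {} z"
    and gen: "\<forall>y. singular_relcycle p X {} y \<longrightarrow> (\<exists>n. homologous_rel p X {} y (frag_cmul n z))"
    and free: "\<forall>n. singular_relboundary p X {} (frag_cmul n z) \<longrightarrow> n = 0"
    using infinite_cyclic_homology_generator[OF assms] by blast
  note lin = linear_real_chain_boundary[of "Suc p"]
  show ?thesis
  proof (intro exI[of _ "of_int_chain z"] conjI allI impI)
    show "real_singular_chain p X (of_int_chain z)" "real_chain_boundary p (of_int_chain z) = 0"
      using z by (simp_all add: singular_cycle real_singular_chain_of_int real_chain_boundary_of_int)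
  next
    fix d assume d: "real_singular_chain (Suc p) X d"
    show "real_chain_boundary (Suc p) d \<noteq> of_int_chain z"
    proof
      assume "real_chain_boundary (Suc p) d = of_int_chain z"
      then obtain N :: nat where "N > 0" "singular_relboundary p X {} (frag_cmul (int N) z)"
        using integral_multiple_bounds[OF d] by blast
      then show False
        using free by fastforce
    qed
  next
    fix c assume c: "real_singular_chain p X c" "real_chain_boundary p c = 0"
    obtain B :: "real set" and y s where B: "finite B" "\<forall>b\<in>B. singular_relcycle p X {} (y b)"
      and ceq: "c = (\<Sum>b\<in>B. s b *\<^sub>R of_int_chain (y b))"
      using real_cycle_decomposition[OF c] by blast
    have "\<exists>n d. singular_chain (Suc p) X d \<and> y b = frag_cmul n z + chain_boundary (Suc p) d" if b: "b \<in> B" for b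
    proof -
      obtain n where "homologous_rel p X {} (y b) (frag_cmul n z)"
        using gen B(2) b by blast
      then obtain d where "singular_chain (Suc p) X d" "chain_boundary (Suc p) d = y b - frag_cmul n z"
        by (auto simp: homologous_rel_def singular_boundary)
      then show ?thesis
        by (metis add.commute diff_add_cancel)
    qed
    then obtain n d where nd: "\<And>b. b \<in> B \<Longrightarrow> singular_chain (Suc p) X (d b) \<and> y b = frag_cmul (n b) z + chain_boundary (Suc p) (d b)"
      by metis
    have y: "of_int_chain (y b) = real_of_int (n b) *\<^sub>R of_int_chain z + real_chain_boundary (Suc p) (of_int_chain (d b))" if "b \<in> B" for b
      using nd[OF that] by (intro poly_mapping_eqI) (simp add: lookup_add real_chain_boundary_of_int)
    define r where "r = (\<Sum>b\<in>B. s b * real_of_int (n b))"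
    define e where "e = (\<Sum>b\<in>B. s b *\<^sub>R of_int_chain (d b))"
    have "real_singular_chain (Suc p) X e"
      unfolding e_def using nd by (intro real_singular_chain_sum real_singular_chain_scaleR) (simp add: real_singular_chain_of_int)
    moreover have "c = r *\<^sub>R of_int_chain z + real_chain_boundary (Suc p) e"
    proof -
      have "c = (\<Sum>b\<in>B. (s b * real_of_int (n b)) *\<^sub>R of_int_chain z + s b *\<^sub>R real_chain_boundary (Suc p) (of_int_chain (d b)))"
        unfolding ceq by (intro sum.cong) (simp_all add: y scaleR_add_right)
      then show ?thesis
        by (simp add: r_def e_def sum.distrib scaleR_sum_left linear_sum[OF lin] linear_scale[OF lin])
    qed
    ultimately show "\<exists>r d. real_singular_chain (Suc p) X d \<and> c = r *\<^sub>R of_int_chain z + real_chain_boundary (Suc p) d"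
      by blast
  qed
qed

lemma real_singular_chain_boundary:
  assumes "real_singular_chain i X c"
  shows "real_singular_chain (i - 1) X (real_chain_boundary i c)"
  unfolding real_singular_chain_def
proof
  fix \<tau> assume "\<tau> \<in> Poly_Mapping.keys (real_chain_boundary i c)"
  then have "(\<Sum>\<sigma>\<in>Poly_Mapping.keys c. Poly_Mapping.lookup c \<sigma> * real_of_int (Poly_Mapping.lookup (chain_boundary i (frag_of \<sigma>)) \<tau>)) \<noteq> 0"
    by (simp add: in_keys_iff lookup_real_chain_boundary[of "Poly_Mapping.keys c"])
  then obtain \<sigma> where \<sigma>: "\<sigma> \<in> Poly_Mapping.keys c" "Poly_Mapping.lookup (chain_boundary i (frag_of \<sigma>)) \<tau> \<noteq> 0"
    by (rule sum.not_neutral_contains_not_neutral) auto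
  then have "singular_chain (i - Suc 0) X (chain_boundary i (frag_of \<sigma>))"
    using assms by (intro singular_chain_boundary) (auto simp: singular_chain_of real_singular_chain_def)
  then show "\<tau> \<in> singular_simplex_set (i - 1) X"
    using \<sigma>(2) by (auto simp: singular_chain_def in_keys_iff subset_iff)
qed

section \<open>Intersection cohomology as a dual space\<close>

context
  fixes X :: "'a topology" and n :: nat and F :: "int \<Rightarrow> 'a set" and p :: "nat \<Rightarrow> int"
begin

lemma intersection_chains_comb:
  assumes "c \<in> intersection_chains X n F p i" "d \<in> intersection_chains X n F p i"
  shows "a *\<^sub>R c + b *\<^sub>R d \<in> intersection_chains X n F p i"
proof -
  have "Poly_Mapping.keys (a *\<^sub>R c + b *\<^sub>R d) \<subseteq> Poly_Mapping.keys c \<union> Poly_Mapping.keys d" for c d :: "'a real_chain"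
    using keys_add[of "a *\<^sub>R c" "b *\<^sub>R d"] keys_scaleR[of a c] keys_scaleR[of b d] by blast
  from this[of c d] this[of "real_chain_boundary i c" "real_chain_boundary i d"] assms show ?thesis
    by (auto simp: intersection_chains_def linear_add[OF linear_real_chain_boundary] linear_scale[OF linear_real_chain_boundary])
qed

lemma intersection_chains_zero: "0 \<in> intersection_chains X n F p i"
  by (simp add: intersection_chains_def linear_0[OF linear_real_chain_boundary])

lemma intersection_cycles_comb:
  assumes "c \<in> intersection_cycles X n F p i" "d \<in> intersection_cycles X n F p i"
  shows "a *\<^sub>R c + b *\<^sub>R d \<in> intersection_cycles X n F p i"
  using assms intersection_chains_comb
  by (simp add: intersection_cycles_def linear_add[OF linear_real_chain_boundary] linear_scale[OF linear_real_chain_boundary])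

lemma intersection_boundaries_comb:
  assumes "c \<in> intersection_boundaries X n F p i" "d \<in> intersection_boundaries X n F p i"
  shows "a *\<^sub>R c + b *\<^sub>R d \<in> intersection_boundaries X n F p i"
proof -
  obtain c' d' where "c = real_chain_boundary (Suc i) c'" "c' \<in> intersection_chains X n F p (Suc i)"
    "d = real_chain_boundary (Suc i) d'" "d' \<in> intersection_chains X n F p (Suc i)"
    using assms by (auto simp: intersection_boundaries_def)
  then show ?thesis
    using intersection_chains_comb[of c' "Suc i" d' a b] unfolding intersection_boundaries_def
    by (intro image_eqI[of _ _ "a *\<^sub>R c' + b *\<^sub>R d'"])
       (simp_all add: linear_add[OF linear_real_chain_boundary] linear_scale[OF linear_real_chain_boundary])
qed

lemma intersection_class_eq_iff:
  "intersection_class X n F p i c = intersection_class X n F p i d \<longleftrightarrow> c - d \<in> intersection_boundaries X n F p i"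
    (is "?L \<longleftrightarrow> ?R")
proof
  have zero: "0 \<in> intersection_boundaries X n F p i"
    using intersection_chains_zero[of "Suc i"] linear_0[OF linear_real_chain_boundary[of "Suc i"]]
    by (force simp: intersection_boundaries_def)
  show ?R if ?L
  proof -
    have "c \<in> intersection_class X n F p i c"
      unfolding intersection_class_def using zero by (intro image_eqI[of _ _ 0]) simp_all
    then have "c \<in> intersection_class X n F p i d"
      using that by simp
    then show ?thesis
      by (auto simp: intersection_class_def)
  qed
  show ?L if R: ?R
  proof -
    have "(+) u ` intersection_boundaries X n F p i \<subseteq> (+) v ` intersection_boundaries X n F p i"
      if "u - v \<in> intersection_boundaries X n F p i" for u v
    proof clarify
      fix b assume "b \<in> intersection_boundaries X n F p i"
      then have "(u - v) + b \<in> intersection_boundaries X n F p i"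
        using intersection_boundaries_comb[OF that, of b 1 1] by simp
      then show "u + b \<in> (+) v ` intersection_boundaries X n F p i"
        by (intro image_eqI[of _ _ "(u - v) + b"]) simp_all
    qed
    moreover have "d - c \<in> intersection_boundaries X n F p i"
      using intersection_boundaries_comb[OF R zero, of "-1" 0] by simp
    ultimately show ?thesis
      using R unfolding intersection_class_def by blast
  qed
qed

lemma intersection_cohomology_trivial:
  assumes "intersection_cycles X n F p i \<subseteq> intersection_boundaries X n F p i"
  shows "intersection_cohomology X n F p i \<cong>\<^sub>\<real> ({0} :: real set)"
proof -
  have zero: "0 \<in> intersection_cycles X n F p i"
    using intersection_chains_zero[of i] by (simp add: intersection_cycles_def linear_0[OF linear_real_chain_boundary])
  have "\<phi> = (\<lambda>_. 0)" if \<phi>: "\<phi> \<in> intersection_cohomology X n F p i" for \<phi>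
  proof
    fix h
    have lin: "\<phi> (intersection_class X n F p i (a *\<^sub>R x + b *\<^sub>R y)) =
        a * \<phi> (intersection_class X n F p i x) + b * \<phi> (intersection_class X n F p i y)"
      if "x \<in> intersection_cycles X n F p i" "y \<in> intersection_cycles X n F p i" for x y a b
      using \<phi> that unfolding intersection_cohomology_def by blast
    show "\<phi> h = 0"
    proof (cases "h \<in> intersection_homology X n F p i")
      case True
      then obtain c where c: "c \<in> intersection_cycles X n F p i" "h = intersection_class X n F p i c"
        by (auto simp: intersection_homology_def)
      have "h = intersection_class X n F p i 0"
        unfolding c(2) intersection_class_eq_iff using c(1) assms by auto
      then show ?thesis
        using lin[OF zero zero, of 0 0] by simp
    next
      case False
      then show ?thesis
        using \<phi> by (simp add: intersection_cohomology_def)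
    qed
  qed
  moreover have "(\<lambda>_. 0) \<in> intersection_cohomology X n F p i"
    by (simp add: intersection_cohomology_def)
  ultimately have "intersection_cohomology X n F p i = {\<lambda>_. 0}"
    by blast
  then show ?thesis
    unfolding linearly_isomorphic_def by (intro exI[of _ "\<lambda>_. 0"]) (simp add: bij_betw_def)
qed

text \<open>
  When the class of \<open>g\<close> spans intersection homology and is not zero, a functional is determined by its value there, and this
  value is arbitrary.
\<close>

lemma intersection_cohomology_line:
  assumes g: "g \<in> intersection_cycles X n F p i" "g \<notin> intersection_boundaries X n F p i"
    and gen: "\<And>c. c \<in> intersection_cycles X n F p i \<Longrightarrow> \<exists>r. c - r *\<^sub>R g \<in> intersection_boundaries X n F p i"
  shows "intersection_cohomology X n F p i \<cong>\<^sub>\<real> (UNIV :: real set)"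
proof -
  let ?cl = "intersection_class X n F p i" and ?Z = "intersection_cycles X n F p i"
    and ?H = "intersection_homology X n F p i" and ?C = "intersection_cohomology X n F p i"
  have multiple_cycle: "r *\<^sub>R g \<in> ?Z" for r
    using intersection_cycles_comb[OF g(1) g(1), of r 0] by simp
  have class_multiple: "\<exists>r. ?cl c = ?cl (r *\<^sub>R g)" if "c \<in> ?Z" for c
    using gen[OF that] by (simp add: intersection_class_eq_iff)
  have coefficient_unique: "r = s" if "?cl (r *\<^sub>R g) = ?cl (s *\<^sub>R g)" for r s
  proof (rule ccontr)
    assume "r \<noteq> s"
    have "(r - s) *\<^sub>R g \<in> intersection_boundaries X n F p i"
      using that by (simp add: intersection_class_eq_iff scaleR_diff_left)
    from intersection_boundaries_comb[OF this this, of "1 / (r - s)" 0] \<open>r \<noteq> s\<close> g(2) show False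
      by simp
  qed
  define coord where "coord h = (SOME r. h = ?cl (r *\<^sub>R g))" for h
  have coord: "?cl c = ?cl (coord (?cl c) *\<^sub>R g)" if "c \<in> ?Z" for c
    unfolding coord_def by (rule someI_ex) (rule class_multiple[OF that])
  have coord_lin: "coord (?cl (a *\<^sub>R x + b *\<^sub>R y)) = a * coord (?cl x) + b * coord (?cl y)"
    if xy: "x \<in> ?Z" "y \<in> ?Z" for x y a b
  proof (rule coefficient_unique)
    have "x - coord (?cl x) *\<^sub>R g \<in> intersection_boundaries X n F p i" "y - coord (?cl y) *\<^sub>R g \<in> intersection_boundaries X n F p i"
      using coord xy by (simp_all flip: intersection_class_eq_iff)
    from intersection_boundaries_comb[OF this, of a b]
    have "?cl (a *\<^sub>R x + b *\<^sub>R y) = ?cl ((a * coord (?cl x) + b * coord (?cl y)) *\<^sub>R g)"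
      by (simp add: intersection_class_eq_iff algebra_simps)
    then show "?cl (coord (?cl (a *\<^sub>R x + b *\<^sub>R y)) *\<^sub>R g) = ?cl ((a * coord (?cl x) + b * coord (?cl y)) *\<^sub>R g)"
      using coord[OF intersection_cycles_comb[OF xy, of a b]] by simp
  qed
  have dual_eq: "\<phi> h = (if h \<in> ?H then coord h * \<phi> (?cl g) else 0)" if \<phi>: "\<phi> \<in> ?C" for \<phi> h
  proof (cases "h \<in> ?H")
    case True
    then obtain c where c: "c \<in> ?Z" "h = ?cl c"
      by (auto simp: intersection_homology_def)
    have "\<phi> (?cl (coord h *\<^sub>R g + 0 *\<^sub>R g)) = coord h * \<phi> (?cl g) + 0 * \<phi> (?cl g)"
      using \<phi> g(1) unfolding intersection_cohomology_def by blast
    then show ?thesis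
      using True coord[OF c(1)] c(2) by simp
  next
    case False
    then show ?thesis
      using \<phi> by (simp add: intersection_cohomology_def)
  qed
  have coord_g: "coord (?cl g) = 1"
    using coord[OF g(1)] by (intro coefficient_unique) simp
  have "bij_betw (\<lambda>\<phi>. \<phi> (?cl g)) ?C UNIV"
    unfolding bij_betw_def
  proof
    show "inj_on (\<lambda>\<phi>. \<phi> (?cl g)) ?C"
    proof (rule inj_onI)
      fix \<phi> \<psi> assume "\<phi> \<in> ?C" "\<psi> \<in> ?C" "\<phi> (?cl g) = \<psi> (?cl g)"
      then show "\<phi> = \<psi>"
        by (intro ext) (simp add: dual_eq)
    qed
    have "s \<in> (\<lambda>\<phi>. \<phi> (?cl g)) ` ?C" for s
    proof (rule image_eqI)
      \<comment> \<open>The functional that takes the value s at the class of g.\<close>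
      let ?\<phi> = "\<lambda>h. if h \<in> ?H then coord h * s else 0"
      have cl: "?cl c \<in> ?H" if "c \<in> ?Z" for c
        using that by (auto simp: intersection_homology_def)
      show "s = ?\<phi> (?cl g)"
        using cl[OF g(1)] coord_g by simp
      show "?\<phi> \<in> ?C"
        unfolding intersection_cohomology_def
        using cl coord_lin intersection_cycles_comb by (auto simp: algebra_simps)
    qed
    then show "(\<lambda>\<phi>. \<phi> (?cl g)) ` ?C = UNIV"
      by blast
  qed
  then show ?thesis
    unfolding linearly_isomorphic_def by (intro exI[of _ "\<lambda>\<phi>. \<phi> (?cl g)"]) simp
qed

end

section \<open>Coning singular chains\<close>

text \<open>
  The join of \<open>\<sigma>\<close> with the origin; the apex is the vertex number \<open>0\<close>, so \<open>\<sigma>\<close> becomes the face opposite to it. At the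
  apex the rescaled barycentric coordinates are meaningless, and the value is the limit.
\<close>

definition cone_simplex :: "nat \<Rightarrow> ((nat \<Rightarrow> real) \<Rightarrow> 'v::real_normed_vector) \<Rightarrow> (nat \<Rightarrow> real) \<Rightarrow> 'v" where
  "cone_simplex i \<sigma> = restrict (\<lambda>t. if t 0 = 1 then 0 else (1 - t 0) *\<^sub>R \<sigma> (\<lambda>j. t (Suc j) / (1 - t 0))) (standard_simplex (Suc i))"

lemma standard_simplex_cone_base:
  assumes t: "t \<in> standard_simplex (Suc i)" "t 0 \<noteq> 1"
  shows "(\<lambda>j. t (Suc j) / (1 - t 0)) \<in> standard_simplex i"
proof -
  have sum: "(\<Sum>j\<le>i. t (Suc j)) = 1 - t 0"
    using t(1) unfolding standard_simplex_def sum.atMost_Suc_shift by simp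
  have pos: "0 < 1 - t 0" and nonneg: "\<And>j. 0 \<le> t j" and zero: "\<And>j. i < j \<Longrightarrow> t (Suc j) = 0"
    using t by (auto simp: standard_simplex_def less_eq_real_def)
  have "t (Suc j) \<le> 1 - t 0" for j
  proof (cases "j \<le> i")
    case True
    then show ?thesis
      unfolding sum[symmetric] using nonneg by (intro member_le_sum) auto
  next
    case False
    then show ?thesis
      using zero[of j] pos by simp
  qed
  then show ?thesis
    using pos nonneg zero sum by (simp add: standard_simplex_def flip: sum_divide_distrib)
qed

lemma standard_simplex_at_apex:
  assumes "t \<in> standard_simplex i" "t 0 = 1"
  shows "t j = (if j = 0 then 1 else 0)"
proof (cases "j = 0 \<or> i < j")
  case True
  then show ?thesis
    using assms by (auto simp: standard_simplex_def)
next
  case False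
  have "t 0 + t j = (\<Sum>l\<in>{0, j}. t l)"
    using False by simp
  also have "\<dots> \<le> (\<Sum>l\<le>i. t l)"
    using False assms(1) by (intro sum_mono2) (auto simp: standard_simplex_def)
  finally have "t j \<le> 0"
    using assms by (simp add: standard_simplex_def)
  then show ?thesis
    using assms(1) False by (simp add: standard_simplex_def order_antisym)
qed

lemma singular_simplex_top_of_set:
  "singular_simplex i (top_of_set X) \<sigma> \<longleftrightarrow>
     continuous_on (standard_simplex i) \<sigma> \<and> \<sigma> ` standard_simplex i \<subseteq> X \<and> \<sigma> \<in> extensional (standard_simplex i)"
  by (auto simp: singular_simplex_def euclidean_product_topology)

text \<open>
  Away from the apex the cone is a composition of continuous maps. At the apex it is continuous because \<open>\<sigma>\<close> is bounded
  on the compact simplex.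
\<close>

lemma singular_simplex_cone:
  assumes \<sigma>: "singular_simplex i (top_of_set X) \<sigma>"
    and X: "\<And>r x. \<lbrakk>x \<in> X; 0 \<le> r; r \<le> 1\<rbrakk> \<Longrightarrow> r *\<^sub>R x \<in> (X :: 'v::real_normed_vector set)"
  shows "singular_simplex (Suc i) (top_of_set X) (cone_simplex i \<sigma>)"
  unfolding singular_simplex_top_of_set
proof (intro conjI)
  let ?S = "standard_simplex (Suc i)"
  define f where "f t = (if t 0 = 1 then 0 else (1 - t 0) *\<^sub>R \<sigma> (\<lambda>j. t (Suc j) / (1 - t 0)))" for t :: "nat \<Rightarrow> real"
  have cont\<sigma>: "continuous_on (standard_simplex i) \<sigma>" and im\<sigma>: "\<sigma> ` standard_simplex i \<subseteq> X"
    using \<sigma> by (simp_all add: singular_simplex_top_of_set)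
  have "compact (standard_simplex i)"
    using compactin_standard_simplex[of i] by (simp add: euclidean_product_topology)
  then have "bounded (\<sigma> ` standard_simplex i)"
    using cont\<sigma> by (intro compact_imp_bounded compact_continuous_image)
  then obtain M where M: "\<And>x. x \<in> standard_simplex i \<Longrightarrow> norm (\<sigma> x) \<le> M"
    by (auto simp: bounded_iff)
  have coord: "continuous_on A (\<lambda>t. t j)" for A :: "(nat \<Rightarrow> real) set" and j
    by (rule continuous_on_product_then_coordinatewise) (rule continuous_on_id)
  have le1: "t 0 \<le> 1" if "t \<in> ?S" for t
    using that by (simp add: standard_simplex_def)
  have f_bound: "norm (f t) \<le> (1 - t 0) * M" if "t \<in> ?S" for t
  proof (cases "t 0 = 1")
    case False
    then show ?thesis
      using M[OF standard_simplex_cone_base[OF that False]] le1[OF that] by (simp add: f_def mult_left_mono)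
  qed (simp add: f_def)
  have "continuous_on ?S f"
    unfolding continuous_on_eq_continuous_within
  proof
    fix t assume t: "t \<in> ?S"
    show "continuous (at t within ?S) f"
    proof (cases "t 0 = 1")
      case True
      have "((\<lambda>s. s 0) \<longlongrightarrow> t 0) (at t within ?S)"
        using coord[of ?S 0] t unfolding continuous_on_def by blast
      then have "((\<lambda>s. (1 - s 0) * M) \<longlongrightarrow> (1 - t 0) * M) (at t within ?S)"
        by (intro tendsto_intros)
      then have lim: "((\<lambda>s. (1 - s 0) * M) \<longlongrightarrow> 0) (at t within ?S)"
        using True by simp
      have "\<forall>\<^sub>F s in at t within ?S. s \<in> ?S"
        by (simp add: eventually_at_filter)
      then have "\<forall>\<^sub>F s in at t within ?S. norm (f s) \<le> (1 - s 0) * M"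
        by (rule eventually_mono) (rule f_bound)
      then have "(f \<longlongrightarrow> 0) (at t within ?S)"
        by (rule Lim_null_comparison[OF _ lim])
      then show ?thesis
        using True by (simp add: continuous_within f_def)
    next
      case False
      let ?U = "{s :: nat \<Rightarrow> real. s 0 < 1}"
      have "open ?U"
        by (intro open_Collect_less coord continuous_on_const)
      have sub: "(\<lambda>s j. s (Suc j) / (1 - s 0)) ` (?S \<inter> ?U) \<subseteq> standard_simplex i"
        using standard_simplex_cone_base by force
      have "continuous_on (?S \<inter> ?U) (\<lambda>s j. s (Suc j) / (1 - s 0))"
        by (intro continuous_on_coordinatewise_then_product continuous_intros coord) simp
      then have "continuous_on (?S \<inter> ?U) (\<lambda>s. (1 - s 0) *\<^sub>R \<sigma> (\<lambda>j. s (Suc j) / (1 - s 0)))"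
        by (intro continuous_on_scaleR continuous_on_diff continuous_on_const coord continuous_on_compose2[OF cont\<sigma> _ sub])
      then have "continuous_on (?S \<inter> ?U) f"
        by (rule continuous_on_eq) (simp add: f_def)
      moreover have "t \<in> ?U"
        using False le1[OF t] by simp
      ultimately have "continuous (at t within ?S \<inter> ?U) f"
        using t by (simp add: continuous_on_eq_continuous_within)
      moreover have "at t within ?S = at t within ?S \<inter> ?U"
        using \<open>t \<in> ?U\<close> \<open>open ?U\<close> by (intro at_within_nhd[of t ?U]) auto
      ultimately show ?thesis
        by simp
    qed
  qed
  then show "continuous_on ?S (cone_simplex i \<sigma>)"
    by (rule continuous_on_eq) (simp add: cone_simplex_def f_def)
  show "cone_simplex i \<sigma> ` ?S \<subseteq> X"
  proof
    fix y assume "y \<in> cone_simplex i \<sigma> ` ?S"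
    then obtain t where t: "t \<in> ?S" "y = f t"
      by (auto simp: cone_simplex_def f_def)
    obtain x0 where "x0 \<in> standard_simplex i"
      using nonempty_standard_simplex by blast
    then have "0 *\<^sub>R \<sigma> x0 \<in> X"
      using im\<sigma> by (intro X) auto
    moreover have "(1 - t 0) *\<^sub>R \<sigma> (\<lambda>j. t (Suc j) / (1 - t 0)) \<in> X" if "t 0 \<noteq> 1"
      using im\<sigma> standard_simplex_cone_base[OF t(1) that] t(1) le1[OF t(1)]
      by (intro X) (auto simp: standard_simplex_def[of "Suc i"])
    ultimately show "y \<in> X"
      by (simp add: t(2) f_def)
  qed
  show "cone_simplex i \<sigma> \<in> extensional ?S"
    by (simp add: cone_simplex_def)
qed

lemma cone_simplex_face_0:
  assumes "\<sigma> \<in> extensional (standard_simplex i)"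
  shows "singular_face (Suc i) 0 (cone_simplex i \<sigma>) = \<sigma>"
proof
  fix x
  show "singular_face (Suc i) 0 (cone_simplex i \<sigma>) x = \<sigma> x"
  proof (cases "x \<in> standard_simplex i")
    case True
    then have "simplical_face 0 x \<in> standard_simplex (Suc i)"
      by (intro simplical_face_in_standard_simplex) auto
    then show ?thesis
      using True by (simp add: singular_face_def cone_simplex_def simplical_face_def)
  next
    case False
    then show ?thesis
      using assms by (simp add: singular_face_def extensional_def)
  qed
qed

lemma cone_simplex_face_Suc:
  assumes "1 \<le> i" "k \<le> i"
  shows "singular_face (Suc i) (Suc k) (cone_simplex i \<sigma>) = cone_simplex (i - 1) (singular_face i k \<sigma>)"
proof
  fix x
  have i: "Suc (i - 1) = i"
    using assms by simp
  show "singular_face (Suc i) (Suc k) (cone_simplex i \<sigma>) x = cone_simplex (i - 1) (singular_face i k \<sigma>) x"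
  proof (cases "x \<in> standard_simplex i")
    case True
    then have "simplical_face (Suc k) x \<in> standard_simplex (Suc i)"
      using assms by (intro simplical_face_in_standard_simplex) auto
    moreover have "(\<lambda>j. x (Suc j) / (1 - x 0)) \<in> standard_simplex (i - 1)" if "x 0 \<noteq> 1"
      using standard_simplex_cone_base[of x "i - 1"] True that i by simp
    moreover have "(\<lambda>j. simplical_face (Suc k) x (Suc j) / (1 - x 0)) = simplical_face k (\<lambda>j. x (Suc j) / (1 - x 0))"
      by (auto simp: simplical_face_def fun_eq_iff)
    moreover have "simplical_face (Suc k) x 0 = x 0"
      by (simp add: simplical_face_def)
    ultimately show ?thesis
      using True i by (simp add: singular_face_def cone_simplex_def)
  next
    case False
    then show ?thesis
      using i by (simp add: singular_face_def cone_simplex_def)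
  qed
qed

definition cone_chain :: "nat \<Rightarrow> 'v::real_normed_vector real_chain \<Rightarrow> 'v real_chain" where
  "cone_chain i c = (\<Sum>\<sigma>\<in>Poly_Mapping.keys c. Poly_Mapping.lookup c \<sigma> *\<^sub>R Poly_Mapping.single (cone_simplex i \<sigma>) 1)"

lemma cone_chain_superset:
  assumes "finite S" "Poly_Mapping.keys c \<subseteq> S"
  shows "cone_chain i c = (\<Sum>\<sigma>\<in>S. Poly_Mapping.lookup c \<sigma> *\<^sub>R Poly_Mapping.single (cone_simplex i \<sigma>) 1)"
  unfolding cone_chain_def using assms by (intro sum.mono_neutral_left) (auto simp: in_keys_iff)

lemma linear_cone_chain: "linear (cone_chain i)"
proof (rule linearI)
  fix c d :: "'v::real_normed_vector real_chain" and r :: real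
  let ?S = "Poly_Mapping.keys c \<union> Poly_Mapping.keys d"
  have S: "finite ?S" "Poly_Mapping.keys c \<subseteq> ?S" "Poly_Mapping.keys d \<subseteq> ?S" "Poly_Mapping.keys (c + d) \<subseteq> ?S"
    "Poly_Mapping.keys (r *\<^sub>R c) \<subseteq> ?S"
    using keys_add[of c d] keys_scaleR[of r c] by auto
  show "cone_chain i (c + d) = cone_chain i c + cone_chain i d"
    unfolding cone_chain_superset[OF S(1,2)] cone_chain_superset[OF S(1,3)] cone_chain_superset[OF S(1,4)]
    by (simp add: lookup_add scaleR_add_left sum.distrib)
  show "cone_chain i (r *\<^sub>R c) = r *\<^sub>R cone_chain i c"
    unfolding cone_chain_superset[OF S(1,2)] cone_chain_superset[OF S(1,5)]
    by (simp add: scaleR_sum_right)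
qed

lemma real_chain_expand: "c = (\<Sum>\<sigma>\<in>Poly_Mapping.keys c. Poly_Mapping.lookup c \<sigma> *\<^sub>R Poly_Mapping.single \<sigma> (1 :: real))"
  by (rule poly_mapping_eqI) (simp add: lookup_sum lookup_single when_def mult_delta_right sum.delta in_keys_iff)

lemma scaleR_single_one: "r *\<^sub>R Poly_Mapping.single x 1 = Poly_Mapping.single x (r :: real)"
  by (rule poly_mapping_eqI) (simp add: lookup_single when_def)

lemma real_chain_boundary_single:
  "0 < i \<Longrightarrow> real_chain_boundary i (Poly_Mapping.single \<sigma> 1) = (\<Sum>k\<le>i. (-1) ^ k *\<^sub>R Poly_Mapping.single (singular_face i k \<sigma>) 1)"
  by (simp add: real_chain_boundary_def scaleR_single_one)

lemma cone_chain_single: "cone_chain i (Poly_Mapping.single \<sigma> 1) = Poly_Mapping.single (cone_simplex i \<sigma>) 1"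
  by (simp add: cone_chain_def)

lemma boundary_cone_simplex:
  assumes "1 \<le> i" "\<sigma> \<in> extensional (standard_simplex i)"
  shows "real_chain_boundary (Suc i) (Poly_Mapping.single (cone_simplex i \<sigma>) 1)
       = Poly_Mapping.single \<sigma> 1 - cone_chain (i - 1) (real_chain_boundary i (Poly_Mapping.single \<sigma> 1))"
proof -
  have "real_chain_boundary (Suc i) (Poly_Mapping.single (cone_simplex i \<sigma>) 1)
      = Poly_Mapping.single \<sigma> 1 + (\<Sum>k\<le>i. (-1) ^ Suc k *\<^sub>R Poly_Mapping.single (singular_face (Suc i) (Suc k) (cone_simplex i \<sigma>)) 1)"
    unfolding real_chain_boundary_single[OF zero_less_Suc] sum.atMost_Suc_shift cone_simplex_face_0[OF assms(2)] by simp
  also have "(\<Sum>k\<le>i. (-1) ^ Suc k *\<^sub>R Poly_Mapping.single (singular_face (Suc i) (Suc k) (cone_simplex i \<sigma>)) (1 :: real))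
      = - (\<Sum>k\<le>i. (-1) ^ k *\<^sub>R Poly_Mapping.single (cone_simplex (i - 1) (singular_face i k \<sigma>)) 1)"
    unfolding sum_negf[symmetric] using assms(1) by (intro sum.cong) (simp_all add: cone_simplex_face_Suc)
  also have "(\<Sum>k\<le>i. (-1) ^ k *\<^sub>R Poly_Mapping.single (cone_simplex (i - 1) (singular_face i k \<sigma>)) (1 :: real))
      = cone_chain (i - 1) (real_chain_boundary i (Poly_Mapping.single \<sigma> 1))"
    using assms(1)
    by (simp add: real_chain_boundary_single linear_sum[OF linear_cone_chain] linear_scale[OF linear_cone_chain] cone_chain_single)
  finally show ?thesis
    by simp
qed

text \<open>
  Coning is a chain homotopy from the identity to zero in positive degrees. In degree \<open>0\<close> the cone on a point has the apex as a
  second face, which this formula does not account for.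
\<close>

lemma boundary_cone_chain:
  assumes "1 \<le> i" "real_singular_chain i X c"
  shows "real_chain_boundary (Suc i) (cone_chain i c) = c - cone_chain (i - 1) (real_chain_boundary i c)"
proof -
  have "real_chain_boundary (Suc i) (cone_chain i c)
      = (\<Sum>\<sigma>\<in>Poly_Mapping.keys c. Poly_Mapping.lookup c \<sigma> *\<^sub>R real_chain_boundary (Suc i) (Poly_Mapping.single (cone_simplex i \<sigma>) 1))"
    by (simp add: cone_chain_def linear_sum[OF linear_real_chain_boundary] linear_scale[OF linear_real_chain_boundary])
  also have "\<dots> = (\<Sum>\<sigma>\<in>Poly_Mapping.keys c. Poly_Mapping.lookup c \<sigma> *\<^sub>R
      (Poly_Mapping.single \<sigma> 1 - cone_chain (i - 1) (real_chain_boundary i (Poly_Mapping.single \<sigma> 1))))"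
    using assms by (intro sum.cong refl) (subst boundary_cone_simplex, auto simp: real_singular_chain_def singular_simplex_def)
  also have "\<dots> = (\<Sum>\<sigma>\<in>Poly_Mapping.keys c. Poly_Mapping.lookup c \<sigma> *\<^sub>R Poly_Mapping.single \<sigma> 1)
     - cone_chain (i - 1) (real_chain_boundary i (\<Sum>\<sigma>\<in>Poly_Mapping.keys c. Poly_Mapping.lookup c \<sigma> *\<^sub>R Poly_Mapping.single \<sigma> 1))"
    by (simp add: scaleR_diff_right sum_subtractf linear_sum[OF linear_real_chain_boundary] linear_scale[OF linear_real_chain_boundary]
        linear_sum[OF linear_cone_chain] linear_scale[OF linear_cone_chain])
  finally show ?thesis
    by (simp flip: real_chain_expand)
qed

section \<open>Intersection cohomology of the implosion\<close>

abbreviation "SU3_allowable \<equiv> allowable_simplices (top_of_set SU3_implosion) 10 SU3_implosion_filtration middle_perversity"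
abbreviation "SU3_chains \<equiv> intersection_chains (top_of_set SU3_implosion) 10 SU3_implosion_filtration middle_perversity"
abbreviation "SU3_cycles \<equiv> intersection_cycles (top_of_set SU3_implosion) 10 SU3_implosion_filtration middle_perversity"
abbreviation "SU3_boundaries \<equiv> intersection_boundaries (top_of_set SU3_implosion) 10 SU3_implosion_filtration middle_perversity"

text \<open>
  The only stratum that imposes a condition is the origin, of codimension \<open>10\<close>. It asks for faces of dimension at most
  \<open>i - 10 + 4\<close>, hence with at most \<open>i - 5\<close> vertices.
\<close>

lemma SU3_allowable_iff:
  "\<sigma> \<in> SU3_allowable i \<longleftrightarrow> singular_simplex i (top_of_set SU3_implosion) \<sigma> \<and>
     (\<forall>x\<in>standard_simplex i. \<sigma> x = 0 \<longrightarrow> int (card {l. x l \<noteq> 0}) \<le> int i - 5)"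
proof -
  have stratum: "SU3_implosion_filtration (int 10 - int k) - SU3_implosion_filtration (int 10 - int k - 1) = (if k = 10 then {0} else {})"
    if "2 \<le> k" for k
    using that by (auto simp: SU3_implosion_filtration_def)
  have "(\<forall>k\<ge>2. {x \<in> standard_simplex i. \<sigma> x \<in> SU3_implosion_filtration (int 10 - int k) - SU3_implosion_filtration (int 10 - int k - 1)}
            \<subseteq> simplex_skeleton i (int i - int k + middle_perversity k))
     \<longleftrightarrow> (\<forall>k\<ge>2. k = 10 \<longrightarrow> {x \<in> standard_simplex i. \<sigma> x = 0} \<subseteq> simplex_skeleton i (int i - int k + middle_perversity k))"
    by (intro all_cong1 imp_cong refl) (auto simp: stratum simp del: of_nat_numeral)
  also have "\<dots> \<longleftrightarrow> (\<forall>x\<in>standard_simplex i. \<sigma> x = 0 \<longrightarrow> int (card {l. x l \<noteq> 0}) \<le> int i - 5)"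
    by (auto simp: middle_perversity_def simplex_skeleton_def subset_iff)
  finally show ?thesis
    by (simp add: allowable_simplices_def)
qed

lemma support_standard_simplex:
  assumes "x \<in> standard_simplex i"
  shows "finite {l. x l \<noteq> 0}" "0 < card {l. x l \<noteq> 0}"
proof -
  have "{l. x l \<noteq> 0} \<subseteq> {..i}"
    using assms by (auto simp: standard_simplex_def not_less[symmetric])
  then show fin: "finite {l. x l \<noteq> 0}"
    by (rule finite_subset) simp
  have "{l. x l \<noteq> 0} \<noteq> {}"
  proof
    assume "{l. x l \<noteq> 0} = {}"
    then have "(\<Sum>l\<le>i. x l) = 0"
      by (intro sum.neutral) auto
    then show False
      using assms by (simp add: standard_simplex_def)
  qed
  then show "0 < card {l. x l \<noteq> 0}"
    using fin by (simp add: card_gt_0_iff)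
qed

lemma SU3_allowable_low:
  assumes "i \<le> 5"
  shows "SU3_allowable i = singular_simplex_set i (top_of_set punctured_implosion)"
proof -
  have "top_of_set punctured_implosion = subtopology (top_of_set SU3_implosion) (- {0})"
    by (simp add: subtopology_subtopology punctured_implosion_def Diff_eq)
  then have "singular_simplex i (top_of_set punctured_implosion) \<sigma> \<longleftrightarrow>
      singular_simplex i (top_of_set SU3_implosion) \<sigma> \<and> (\<forall>x\<in>standard_simplex i. \<sigma> x \<noteq> 0)" for \<sigma>
    by (auto simp: singular_simplex_subtopology)
  moreover have "\<not> int (card {l. x l \<noteq> 0}) \<le> int i - 5" if "x \<in> standard_simplex i" for x
    using support_standard_simplex(2)[OF that] assms by linarith
  ultimately show ?thesis
    by (auto simp: SU3_allowable_iff)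
qed

lemma SU3_chains_low:
  assumes "i \<le> 5"
  shows "c \<in> SU3_chains i \<longleftrightarrow> real_singular_chain i (top_of_set punctured_implosion) c"
  using real_singular_chain_boundary[of i "top_of_set punctured_implosion" c] SU3_allowable_low[of i] SU3_allowable_low[of "i - 1"] assms
  by (auto simp: intersection_chains_def real_singular_chain_def)

text \<open>
  A point of the cone over a point with at most \<open>i - 5\<close> nonzero coordinates has at most one more. The apex has one
  nonzero coordinate, and it is allowed as \<open>1 \<le> i + 1 - 5\<close>.
\<close>

lemma SU3_allowable_cone:
  assumes "5 \<le> i" "\<sigma> \<in> SU3_allowable i"
  shows "cone_simplex i \<sigma> \<in> SU3_allowable (Suc i)"
  unfolding SU3_allowable_iff
proof (intro conjI ballI impI)
  have scale: "r *\<^sub>R u \<in> SU3_implosion" if "u \<in> SU3_implosion" for r u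
  proof (cases u)
    case (Pair z w)
    have "(\<Sum>k\<in>UNIV. (r *\<^sub>R z) $ k * (r *\<^sub>R w) $ k) = (r * r) *\<^sub>R (\<Sum>k\<in>UNIV. z $ k * w $ k)"
      by (simp add: scaleR_sum_right)
    then show ?thesis
      using that by (simp add: SU3_implosion_def Pair)
  qed
  show "singular_simplex (Suc i) (top_of_set SU3_implosion) (cone_simplex i \<sigma>)"
    using assms(2) scale by (intro singular_simplex_cone) (auto simp: SU3_allowable_iff)
next
  fix x assume x: "x \<in> standard_simplex (Suc i)" "cone_simplex i \<sigma> x = 0"
  show "int (card {l. x l \<noteq> 0}) \<le> int (Suc i) - 5"
  proof (cases "x 0 = 1")
    case True
    then have "{l. x l \<noteq> 0} = {0}"
      using standard_simplex_at_apex[OF x(1) True] by auto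
    then show ?thesis
      using assms(1) by simp
  next
    case False
    let ?y = "\<lambda>j. x (Suc j) / (1 - x 0)"
    have y: "?y \<in> standard_simplex i"
      by (rule standard_simplex_cone_base[OF x(1) False])
    moreover have "\<sigma> ?y = 0"
      using x False by (simp add: cone_simplex_def)
    ultimately have bound: "int (card {l. ?y l \<noteq> 0}) \<le> int i - 5"
      using assms(2) unfolding SU3_allowable_iff by blast
    have "{l. x l \<noteq> 0} \<subseteq> insert 0 (Suc ` {l. ?y l \<noteq> 0})"
    proof
      fix l assume "l \<in> {l. x l \<noteq> 0}"
      then show "l \<in> insert 0 (Suc ` {l. ?y l \<noteq> 0})"
        using False by (cases l) auto
    qed
    then have "card {l. x l \<noteq> 0} \<le> card (insert 0 (Suc ` {l. ?y l \<noteq> 0}))"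
      using support_standard_simplex(1)[OF y] by (intro card_mono) auto
    also have "\<dots> \<le> Suc (card (Suc ` {l. ?y l \<noteq> 0}))"
      using support_standard_simplex(1)[OF y] by (simp add: card_insert_if)
    also have "card (Suc ` {l. ?y l \<noteq> 0}) = card {l. ?y l \<noteq> 0}"
      by (simp add: card_image)
    finally show ?thesis
      using bound by linarith
  qed
qed

lemma SU3_cycles_bound_high:
  assumes "5 \<le> i"
  shows "SU3_cycles i \<subseteq> SU3_boundaries i"
proof
  fix c assume c: "c \<in> SU3_cycles i"
  then have keys: "Poly_Mapping.keys c \<subseteq> SU3_allowable i" and bd: "real_chain_boundary i c = 0"
    by (auto simp: intersection_cycles_def intersection_chains_def)
  have "real_singular_chain i (top_of_set SU3_implosion) c"
    using keys by (auto simp: real_singular_chain_def SU3_allowable_iff)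
  then have cone: "real_chain_boundary (Suc i) (cone_chain i c) = c"
    using boundary_cone_chain[of i _ c] assms by (simp add: bd linear_0[OF linear_cone_chain])
  have "Poly_Mapping.keys (cone_chain i c) \<subseteq> cone_simplex i ` Poly_Mapping.keys c"
  proof -
    have "Poly_Mapping.keys (cone_chain i c)
        \<subseteq> (\<Union>\<sigma>\<in>Poly_Mapping.keys c. Poly_Mapping.keys (Poly_Mapping.lookup c \<sigma> *\<^sub>R Poly_Mapping.single (cone_simplex i \<sigma>) (1 :: real)))"
      unfolding cone_chain_def by (rule keys_sum)
    also have "\<dots> \<subseteq> cone_simplex i ` Poly_Mapping.keys c"
      using keys_scaleR by (force split: if_splits)
    finally show ?thesis .
  qed
  then have "cone_chain i c \<in> SU3_chains (Suc i)"
    using SU3_allowable_cone[OF assms] keys by (auto simp: intersection_chains_def cone)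
  then show "c \<in> SU3_boundaries i"
    unfolding intersection_boundaries_def using cone by (metis image_eqI)
qed

theorem theorem4p2:
  fixes j :: nat
  shows "(j = 0 \<or> j = 4 \<longrightarrow> IH_SU3_implosion j \<cong>\<^sub>\<real> (UNIV :: real set)) \<and>
         (j = 1 \<or> j = 2 \<or> j = 3 \<or> j \<ge> 5 \<longrightarrow> IH_SU3_implosion j \<cong>\<^sub>\<real> ({0} :: real set))"
proof (intro conjI impI)
  let ?N = "top_of_set punctured_implosion"
  have cycles: "c \<in> SU3_cycles j \<longleftrightarrow> real_singular_chain j ?N c \<and> real_chain_boundary j c = 0" if "j \<le> 4" for c
    using that SU3_chains_low[of j c] by (simp add: intersection_cycles_def)
  have boundaries: "c \<in> SU3_boundaries j \<longleftrightarrow> (\<exists>d. real_singular_chain (Suc j) ?N d \<and> real_chain_boundary (Suc j) d = c)" if "j \<le> 4" for c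
    using that SU3_chains_low[of "Suc j"] by (auto simp: intersection_boundaries_def)
  show "IH_SU3_implosion j \<cong>\<^sub>\<real> (UNIV :: real set)" if j: "j = 0 \<or> j = 4"
  proof -
    have "homology_group (int j) ?N \<cong> integer_group"
      using j by (intro homology_group_punctured_implosion) auto
    then obtain g where g: "real_singular_chain j ?N g" "real_chain_boundary j g = 0"
      "\<forall>d. real_singular_chain (Suc j) ?N d \<longrightarrow> real_chain_boundary (Suc j) d \<noteq> g"
      "\<forall>c. real_singular_chain j ?N c \<longrightarrow> real_chain_boundary j c = 0 \<longrightarrow>
         (\<exists>r d. real_singular_chain (Suc j) ?N d \<and> c = r *\<^sub>R g + real_chain_boundary (Suc j) d)"
      using infinite_cyclic_homology_real_generator by blast
    have "j \<le> 4"
      using j by auto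
    show ?thesis
      unfolding IH_SU3_implosion_def
    proof (rule intersection_cohomology_line)
      show "g \<in> SU3_cycles j" "g \<notin> SU3_boundaries j"
        using g(1-3) cycles[OF \<open>j \<le> 4\<close>] boundaries[OF \<open>j \<le> 4\<close>] by auto
      fix c assume "c \<in> SU3_cycles j"
      then obtain r d where "real_singular_chain (Suc j) ?N d" "c = r *\<^sub>R g + real_chain_boundary (Suc j) d"
        using g(4) cycles[OF \<open>j \<le> 4\<close>] by blast
      then show "\<exists>r. c - r *\<^sub>R g \<in> SU3_boundaries j"
        unfolding boundaries[OF \<open>j \<le> 4\<close>] by (intro exI[of _ r] exI[of _ d]) simp
    qed
  qed
  show "IH_SU3_implosion j \<cong>\<^sub>\<real> ({0} :: real set)" if j: "j = 1 \<or> j = 2 \<or> j = 3 \<or> j \<ge> 5"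
    unfolding IH_SU3_implosion_def
  proof (rule intersection_cohomology_trivial)
    show "SU3_cycles j \<subseteq> SU3_boundaries j"
    proof (cases "5 \<le> j")
      case True
      then show ?thesis
        by (rule SU3_cycles_bound_high)
    next
      case False
      then have "j \<le> 4" and triv: "trivial_group (homology_group (int j) ?N)"
        using j by (auto intro!: trivial_homology_group_punctured_implosion)
      show ?thesis
      proof
        fix c assume "c \<in> SU3_cycles j"
        then have "real_singular_chain j ?N c" "real_chain_boundary j c = 0"
          by (simp_all add: cycles[OF \<open>j \<le> 4\<close>])
        then obtain d where "real_singular_chain (Suc j) ?N d" "real_chain_boundary (Suc j) d = c"
          by (rule trivial_homology_real_cycle_bounds[OF triv])
        then show "c \<in> SU3_boundaries j"
          unfolding boundaries[OF \<open>j \<le> 4\<close>] by blast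
      qed
    qed
  qed
qed

end
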